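(* Let $V=V_0\oplus V_1$ be a $\mathbb{Z}_2$-graded complex vector space and let $R=\mathbb{C}[\partial]\otimes_{\mathbb{C}}V$ be the free $\mathbb{C}[\partial]$-module over $V$, with the induced $\mathbb{Z}_2$-grading ($\partial(R_i)\subset R_i$). Quadratic conformal superalgebra structures on $R$ over $V$ are equivalent to super Gel'fand-Dorfman bialgebra structures on $V$, in the following sense. (i) If $(R,\partial,Y^+(\cdot,z))$ is a quadratic conformal superalgebra (over $V$), then there are unique bilinear operations $[\cdot,\cdot]$ and $\circ$ on $V$ such that for $u\in V_i$, $v\in V_j$, $$Y^+(u,z)v=\big(\partial(v\circ u)+[v,u]\big)z^{-1}+\big(v\circ u+(-1)^{ij}u\circ v\big)z^{-2},\qquad ( * )$$ and $(V,[\cdot,\cdot],\circ)$ is a super Gel'fand-Dorfman bialgebra. (ii) Conversely, if $(V,[\cdot,\cdot],\circ)$ is a super Gel'fand-Dorfman bialgebra, then there is a unique conformal superalgebra structure $(R,\partial,Y^+(\cdot,z))$ on $R$ satisfying $( * )$ for all $u\in V_i$, $v\in V_j$; it is a quadratic conformal superalgebra.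
   Context: All vector spaces are over $\mathbb{C}$; $\mathbb{Z}_2=\{0,1\}$. $LM(V_1,V_2)$ is the space of linear maps $V_1\to V_2$. $\mathrm{Res}_z(z^n)=\delta_{n,-1}$. All binomials such as $(z-x)^{-n}$ are expanded in nonnegative powers of the second variable $x$. A conformal superalgebra $(R,\partial,Y^+(\cdot,z))$ is a $\mathbb{Z}_2$-graded $\mathbb{C}[\partial]$-module $R=R_0\oplus R_1$ ($\partial R_i\subset R_i$) with a $\mathbb{Z}_2$-graded linear map $Y^+(\cdot,z):R\to LM(R,R[z^{-1}]z^{-1})$ (so $Y^+(u,z)v\in R_{i+j}[z^{-1}]z^{-1}$ for $u\in R_i,v\in R_j$) such that $Y^+(\partial u,z)=\frac{d}{dz}Y^+(u,z)$ for $u\in R$, and for $u\in R_i$, $v\in R_j$: $$Y^+(u,z)v=(-1)^{ij}\mathrm{Res}_x\frac{e^{x\partial}Y^+(v,-x)u}{z-x},$$ $$Y^+(u,z_1)Y^+(v,z_2)-(-1)^{ij}Y^+(v,z_2)Y^+(u,z_1)=\mathrm{Res}_x\frac{Y^+(Y^+(u,z_1-x)v,x)}{z_2-x}.$$ A quadratic conformal superalgebra is a conformal superalgebra $R$ that is a free $\mathbb{C}[\partial]$-module over a $\mathbb{Z}_2$-graded subspace $V$ ($R=\mathbb{C}[\partial]V\cong\mathbb{C}[\partial]\otimes V$) such that for all $u,v\in V$, $Y^+(u,z)v=(w_1+\partial w_2)z^{-1}+w_3z^{-2}$ for some $w_1,w_2,w_3\in V$. All operations below on a $\mathbb{Z}_2$-graded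 space are bilinear and $\mathbb{Z}_2$-graded. A Lie superalgebra $L=L_0\oplus L_1$ satisfies $[u,v]=-(-1)^{ij}[v,u]$ and $[w,[v,u]]=[[w,v],u]-(-1)^{ij}[[w,u],v]$ for $u\in L_i,v\in L_j,w\in L$. A Novikov superalgebra $(\mathcal{A},\circ)$ satisfies $(u\circ v)\circ w=(-1)^{jl}(u\circ w)\circ v$ and $(u,v,w)=(-1)^{ij}(v,u,w)$ for $u\in\mathcal{A}_i,v\in\mathcal{A}_j,w\in\mathcal{A}_l$, where $(u,v,w)=(u\circ v)\circ w-u\circ(v\circ w)$. A super Gel'fand-Dorfman bialgebra $(\mathcal{A},[\cdot,\cdot],\circ)$ is a $\mathbb{Z}_2$-graded space such that $(\mathcal{A},[\cdot,\cdot])$ is a Lie superalgebra, $(\mathcal{A},\circ)$ is a Novikov superalgebra and $$[w\circ u,v]-(-1)^{ij}[w\circ v,u]+[w,u]\circ v-(-1)^{ij}[w,v]\circ u-w\circ[u,v]=0$$ for $u\in\mathcal{A}_i$, $v\in\mathcal{A}_j$, $w\in\mathcal{A}$. *)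

theory Defs
  imports
    Complex_Main
    "HOL-Library.Z2"
    "HOL-Library.Groups_Big_Fun"
    "HOL-Computational_Algebra.Polynomial"
begin

text \<open>
  The group \<open>\<int>\<^sub>2\<close> is the type \<^typ>\<open>bit\<close>.  Complex vector spaces are
  types of class \<^class>\<open>ab_group_add\<close> with an explicit scalar multiplication
  satisfying \<^locale>\<open>vector_space\<close>.
\<close>

definition parity_sign :: "bit \<Rightarrow> bit \<Rightarrow> complex" where
  "parity_sign i j = (if i * j = 1 then - 1 else 1)"

locale superspace = vector_space scale
  for scale :: "complex \<Rightarrow> 'a::ab_group_add \<Rightarrow> 'a" +
  fixes G :: "bit \<Rightarrow> 'a set"
  assumes subspace_G: "subspace (G i)"
    and G_inter: "G 0 \<inter> G 1 = {0}"
    and G_sum: "\<exists>a\<in>G 0. \<exists>b\<in>G 1. v = a + b"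

definition bilinear_op ::
  "(complex \<Rightarrow> 'a::ab_group_add \<Rightarrow> 'a) \<Rightarrow> ('a \<Rightarrow> 'a \<Rightarrow> 'a) \<Rightarrow> bool" where
  "bilinear_op scale f \<longleftrightarrow>
     (\<forall>v. Vector_Spaces.linear scale scale (\<lambda>u. f u v)) \<and>
     (\<forall>u. Vector_Spaces.linear scale scale (\<lambda>v. f u v))"

definition graded_op :: "(bit \<Rightarrow> 'a set) \<Rightarrow> ('a \<Rightarrow> 'a \<Rightarrow> 'a) \<Rightarrow> bool" where
  "graded_op G f \<longleftrightarrow> (\<forall>i j. \<forall>u\<in>G i. \<forall>v\<in>G j. f u v \<in> G (i + j))"

locale lie_superalgebra = superspace scale L
  for scale :: "complex \<Rightarrow> 'a::ab_group_add \<Rightarrow> 'a" and L +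
  fixes br :: "'a \<Rightarrow> 'a \<Rightarrow> 'a"
  assumes br_bilinear: "bilinear_op scale br"
    and br_graded: "graded_op L br"
    and br_skew: "u \<in> L i \<Longrightarrow> v \<in> L j \<Longrightarrow>
      br u v = - scale (parity_sign i j) (br v u)"
    and br_jacobi: "u \<in> L i \<Longrightarrow> v \<in> L j \<Longrightarrow>
      br w (br v u) = br (br w v) u - scale (parity_sign i j) (br (br w u) v)"

definition associator :: "('a::minus \<Rightarrow> 'a \<Rightarrow> 'a) \<Rightarrow> 'a \<Rightarrow> 'a \<Rightarrow> 'a \<Rightarrow> 'a" where
  "associator f u v w = f (f u v) w - f u (f v w)"

locale novikov_superalgebra = superspace scale A
  for scale :: "complex \<Rightarrow> 'a::ab_group_add \<Rightarrow> 'a" and A +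
  fixes circ :: "'a \<Rightarrow> 'a \<Rightarrow> 'a"
  assumes circ_bilinear: "bilinear_op scale circ"
    and circ_graded: "graded_op A circ"
    and circ_right_comm: "u \<in> A i \<Longrightarrow> v \<in> A j \<Longrightarrow> w \<in> A l \<Longrightarrow>
      circ (circ u v) w = scale (parity_sign j l) (circ (circ u w) v)"
    and circ_left_sym: "u \<in> A i \<Longrightarrow> v \<in> A j \<Longrightarrow> w \<in> A l \<Longrightarrow>
      associator circ u v w = scale (parity_sign i j) (associator circ v u w)"

locale super_gelfand_dorfman =
  lie_superalgebra scale A br + novikov_superalgebra scale A circ
  for scale :: "complex \<Rightarrow> 'a::ab_group_add \<Rightarrow> 'a" and A br circ +
  assumes compatible: "u \<in> A i \<Longrightarrow> v \<in> A j \<Longrightarrow>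
      br (circ w u) v - scale (parity_sign i j) (br (circ w v) u)
      + circ (br w u) v - scale (parity_sign i j) (circ (br w v) u)
      - circ w (br u v) = 0"

text \<open>
  Formal calculus: a formal series in one variable is the function \<open>int \<Rightarrow> 'r\<close>
  sending \<open>n\<close> to the coefficient of the \<open>n\<close>-th power, and a series in two
  variables \<open>z, x\<close> sends \<open>m, n\<close> to the coefficient of \<open>z^m x^n\<close>.  The sums
  \<^const>\<open>Sum_any\<close> below have only finitely many nonzero terms for the arguments
  that occur in a conformal superalgebra.
\<close>

definition polar_part :: "(int \<Rightarrow> 'r::zero) \<Rightarrow> bool"  \<comment> \<open>membership in \<open>R[z\<^sup>-\<^sup>1]z\<^sup>-\<^sup>1\<close>\<close> where
  "polar_part f \<longleftrightarrow> finite {n. f n \<noteq> 0} \<and> (\<forall>n\<ge>0. f n = 0)"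

definition zterm :: "'r::zero \<Rightarrow> int \<Rightarrow> int \<Rightarrow> 'r"  \<comment> \<open>the series \<open>a z^k\<close>\<close> where
  "zterm a k = (\<lambda>n. if n = k then a else 0)"

definition Res :: "(int \<Rightarrow> 'r) \<Rightarrow> 'r" where
  "Res f = f (- 1)"

definition fderiv ::
  "(complex \<Rightarrow> 'r \<Rightarrow> 'r) \<Rightarrow> (int \<Rightarrow> 'r) \<Rightarrow> int \<Rightarrow> 'r"  \<comment> \<open>\<open>d/dz\<close>\<close> where
  "fderiv scale f = (\<lambda>n. scale (of_int (n + 1)) (f (n + 1)))"

definition neg_arg ::
  "(complex \<Rightarrow> 'r \<Rightarrow> 'r) \<Rightarrow> (int \<Rightarrow> 'r) \<Rightarrow> int \<Rightarrow> 'r"  \<comment> \<open>\<open>f(-x)\<close>\<close> where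
  "neg_arg scale f = (\<lambda>n. scale ((- 1) powi n) (f n))"

definition exp_act ::  \<comment> \<open>\<open>e^(x\<partial>) f(x)\<close>\<close>
  "(complex \<Rightarrow> 'r \<Rightarrow> 'r) \<Rightarrow> ('r \<Rightarrow> 'r) \<Rightarrow> (int \<Rightarrow> 'r::comm_monoid_add) \<Rightarrow> int \<Rightarrow> 'r" where
  "exp_act scale d f =
     (\<lambda>n. Sum_any (\<lambda>k::nat. scale (1 / fact k) ((d ^^ k) (f (n - int k)))))"

definition binom_series :: "int \<Rightarrow> int \<Rightarrow> int \<Rightarrow> complex"
    \<comment> \<open>\<open>(z - x)^k\<close>, expanded in nonnegative powers of \<open>x\<close>\<close> where
  "binom_series k = (\<lambda>m n. if n \<ge> 0 \<and> m = k - n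
     then (- 1) ^ nat n * (of_int k gchoose nat n) else 0)"

definition mult_binom ::  \<comment> \<open>\<open>(z - x)^k f(x)\<close>\<close>
  "(complex \<Rightarrow> 'r \<Rightarrow> 'r) \<Rightarrow> int \<Rightarrow> (int \<Rightarrow> 'r::comm_monoid_add) \<Rightarrow> int \<Rightarrow> int \<Rightarrow> 'r" where
  "mult_binom scale k f =
     (\<lambda>m n. Sum_any (\<lambda>l. scale (binom_series k m l) (f (n - l))))"

definition subst_diff ::  \<comment> \<open>\<open>f(z - x)\<close>\<close>
  "(complex \<Rightarrow> 'r \<Rightarrow> 'r) \<Rightarrow> (int \<Rightarrow> 'r::comm_monoid_add) \<Rightarrow> int \<Rightarrow> int \<Rightarrow> 'r" where
  "subst_diff scale f =
     (\<lambda>m n. Sum_any (\<lambda>k. scale (binom_series k m n) (f k)))"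

definition Y_series ::  \<comment> \<open>\<open>Y\<^sup>+(a(x), x) w\<close> for an \<open>R\<close>-valued series \<open>a(x)\<close>\<close>
  "('r \<Rightarrow> 'r \<Rightarrow> int \<Rightarrow> 'r) \<Rightarrow> (int \<Rightarrow> 'r) \<Rightarrow> 'r \<Rightarrow> int \<Rightarrow> 'r::comm_monoid_add" where
  "Y_series Y a w = (\<lambda>n. Sum_any (\<lambda>l. Y (a l) w (n - l)))"

text \<open>
  \<open>Y u v\<close> is the series \<open>Y\<^sup>+(u,z)v\<close>.  In \<open>Y_commutator\<close>, \<open>m\<close> and \<open>n\<close> are the
  exponents of \<open>z\<^sub>1\<close> and \<open>z\<^sub>2\<close>.
\<close>

locale conformal_superalgebra = superspace scale R
  for scale :: "complex \<Rightarrow> 'r::ab_group_add \<Rightarrow> 'r" and R +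
  fixes d :: "'r \<Rightarrow> 'r"
    and Y :: "'r \<Rightarrow> 'r \<Rightarrow> int \<Rightarrow> 'r"
  assumes d_linear: "Vector_Spaces.linear scale scale d"
    and d_graded: "u \<in> R i \<Longrightarrow> d u \<in> R i"
    and Y_bilinear: "bilinear_op scale (\<lambda>u v. Y u v n)"
    and Y_polar: "polar_part (Y u v)"
    and Y_graded: "graded_op R (\<lambda>u v. Y u v n)"
    and Y_deriv: "Y (d u) v = fderiv scale (Y u v)"
    and Y_skew: "u \<in> R i \<Longrightarrow> v \<in> R j \<Longrightarrow>
      Y u v = (\<lambda>m. scale (parity_sign i j)
        (Res (mult_binom scale (- 1) (exp_act scale d (neg_arg scale (Y v u))) m)))"
    and Y_commutator: "u \<in> R i \<Longrightarrow> v \<in> R j \<Longrightarrow>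
      Y u (Y v w n) m - scale (parity_sign i j) (Y v (Y u w m) n) =
      Res (mult_binom scale (- 1) (Y_series Y (subst_diff scale (Y u v) m) w) n)"

definition free_over :: "('r \<Rightarrow> 'r) \<Rightarrow> 'r::comm_monoid_add set \<Rightarrow> bool"
    \<comment> \<open>the action map \<open>\<complex>[\<partial>] \<otimes> V \<rightarrow> R\<close> is bijective\<close> where
  "free_over d V \<longleftrightarrow> (\<forall>r. \<exists>!c :: nat \<Rightarrow> 'r.
     range c \<subseteq> V \<and> finite {n. c n \<noteq> 0} \<and> r = (\<Sum>n | c n \<noteq> 0. (d ^^ n) (c n)))"

locale quadratic_conformal_superalgebra = conformal_superalgebra scale R d Y
  for scale :: "complex \<Rightarrow> 'r::ab_group_add \<Rightarrow> 'r" and R d Y +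
  fixes V :: "'r set"
  assumes subspace_V: "subspace V"
    and V_graded: "v \<in> V \<Longrightarrow> \<exists>a\<in>V \<inter> R 0. \<exists>b\<in>V \<inter> R 1. v = a + b"
    and free_V: "free_over d V"
    and quadratic: "u \<in> V \<Longrightarrow> v \<in> V \<Longrightarrow>
      \<exists>w1\<in>V. \<exists>w2\<in>V. \<exists>w3\<in>V.
        Y u v = (\<lambda>n. zterm (w1 + d w2) (- 1) n + zterm w3 (- 2) n)"

text \<open>
  The free module \<open>\<complex>[\<partial>] \<otimes> V\<close> is modelled by polynomials in \<open>\<partial>\<close> with
  coefficients in \<open>V\<close>: \<open>\<partial>^n \<otimes> v\<close> is \<open>monom v n\<close>, and \<open>v\<close> is identified with
  \<open>1 \<otimes> v = [:v:]\<close>.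
\<close>

definition free_scale ::
  "(complex \<Rightarrow> 'v \<Rightarrow> 'v) \<Rightarrow> complex \<Rightarrow> 'v::zero poly \<Rightarrow> 'v poly" where
  "free_scale scale c = map_poly (scale c)"

definition free_grading :: "(bit \<Rightarrow> 'v set) \<Rightarrow> bit \<Rightarrow> 'v::zero poly set" where
  "free_grading V i = {p. \<forall>n. coeff p n \<in> V i}"

definition free_del :: "'v::zero poly \<Rightarrow> 'v poly" where
  "free_del p = pCons 0 p"

definition free_gens :: "'v::zero poly set" where
  "free_gens = range (\<lambda>v. [:v:])"

definition gd_formula ::
  "(complex \<Rightarrow> 'v \<Rightarrow> 'v) \<Rightarrow> (bit \<Rightarrow> 'v set) \<Rightarrow> ('v \<Rightarrow> 'v \<Rightarrow> 'v) \<Rightarrow> ('v \<Rightarrow> 'v \<Rightarrow> 'v) \<Rightarrow>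
   ('v::ab_group_add poly \<Rightarrow> 'v poly \<Rightarrow> int \<Rightarrow> 'v poly) \<Rightarrow> bool" where
  "gd_formula scale V br circ Y \<longleftrightarrow> (\<forall>i j. \<forall>u\<in>V i. \<forall>v\<in>V j.
     Y [:u:] [:v:] = (\<lambda>n.
       zterm (free_del [:circ v u:] + [:br v u:]) (- 1) n +
       zterm [:circ v u + scale (parity_sign i j) (circ u v):] (- 2) n))"

end

theory Submission
  imports Defs
begin

text \<open>
  Writing \<open>u\<^sub>(\<^sub>n\<^sub>) v\<close> for the coefficient of \<open>z\<^sup>-\<^sup>n\<^sup>-\<^sup>1\<close> in \<open>Y\<^sup>+(u,z)v\<close>, skew-symmetry becomes a finite sum
  and the commutator formula becomes Borcherds' identity
  \<open>u\<^sub>(\<^sub>m\<^sub>) v\<^sub>(\<^sub>n\<^sub>) w \<mp> v\<^sub>(\<^sub>n\<^sub>) u\<^sub>(\<^sub>m\<^sub>) w = (\<Sum>l\<le>m. (m choose l) (u\<^sub>(\<^sub>m\<^sub>-\<^sub>l\<^sub>) v)\<^sub>(\<^sub>n\<^sub>+\<^sub>l\<^sub>) w)\<close>.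
  The rules for the products of \<open>\<partial>u\<close> and \<open>\<partial>v\<close> show that the set of arguments on which either axiom holds
  is closed under \<open>\<partial>\<close>, so both need only be examined on \<open>V\<close>.  There the difference of the two sides
  of Borcherds' identity vanishes except for \<open>m + n \<le> 2\<close>.  The coefficients of \<open>1\<close>, \<open>\<partial>\<close>, \<open>\<partial>\<^sup>2\<close> for \<open>m = n = 0\<close>
  are the Jacobi identity, the compatibility condition and right commutativity; left symmetry is read
  off from the coefficient of \<open>\<partial>\<close> for \<open>m = 1\<close>, \<open>n = 0\<close>; and all remaining coefficients are combinations of
  these identities.
\<close>

section \<open>The calculus of \<open>n\<close>-th products\<close>

locale del_module = vector_space scale
  for scale :: "complex \<Rightarrow> 'r::ab_group_add \<Rightarrow> 'r" +
  fixes d :: "'r \<Rightarrow> 'r"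
  assumes d_linear: "Vector_Spaces.linear scale scale d"
begin

sublocale D: Vector_Spaces.linear scale scale d
  by (rule d_linear)

text \<open>If \<open>f n\<close> is the product \<open>u\<^sub>(\<^sub>n\<^sub>) v\<close>, then \<open>left_shift f\<close> and \<open>right_shift f\<close> give the products of
  \<open>\<partial>u, v\<close> and of \<open>u, \<partial>v\<close>, and \<open>skew_sum f\<close> gives those of \<open>v, u\<close> up to the sign \<open>(-1)\<^sup>i\<^sup>j\<close>.\<close>

definition left_shift :: "(nat \<Rightarrow> 'r) \<Rightarrow> nat \<Rightarrow> 'r" where
  "left_shift f n = - scale (of_nat n) (f (n - 1))"

definition right_shift :: "(nat \<Rightarrow> 'r) \<Rightarrow> nat \<Rightarrow> 'r" where
  "right_shift f n = d (f n) + scale (of_nat n) (f (n - 1))"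

definition skew_sum :: "(nat \<Rightarrow> 'r) \<Rightarrow> nat \<Rightarrow> 'r" where
  "skew_sum f n = Sum_any (\<lambda>k. scale ((- 1) ^ Suc (n + k) / fact k) ((d ^^ k) (f (n + k))))"

lemma dpow_zero [simp]: "(d ^^ k) 0 = 0"
  by (induction k) (simp_all add: D.zero)

lemma dpow_add: "(d ^^ k) (x + y) = (d ^^ k) x + (d ^^ k) y"
  by (induction k) (simp_all add: D.add)

lemma dpow_minus: "(d ^^ k) (- x) = - (d ^^ k) x"
  by (induction k) (simp_all add: D.neg)

lemma dpow_diff: "(d ^^ k) (x - y) = (d ^^ k) x - (d ^^ k) y"
  using dpow_add[of k x "- y"] by (simp add: dpow_minus)

lemma dpow_scale: "(d ^^ k) (scale c x) = scale c ((d ^^ k) x)"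
  by (induction k) (simp_all add: D.scale)

text \<open>The cut-off \<open>N\<close> may be any bound from \<open>B\<close> on, so that sums
  belonging to different products can be brought over one common range.\<close>

lemma skew_sum_eq:
  assumes "\<And>m. m \<ge> B \<Longrightarrow> f m = 0" and "B \<le> N"
  shows "skew_sum f n = (\<Sum>k<N. scale ((- 1) ^ Suc (n + k) / fact k) ((d ^^ k) (f (n + k))))"
  unfolding skew_sum_def
proof (rule Sum_any.expand_superset)
  show "{k. scale ((- 1) ^ Suc (n + k) / fact k) ((d ^^ k) (f (n + k))) \<noteq> 0} \<subseteq> {..<N}"
  proof (clarsimp, rule ccontr)
    fix k assume "\<not> k < N" then have "f (n + k) = 0"
      using assms by simp
    moreover assume "(d ^^ k) (f (n + k)) \<noteq> 0"
    ultimately show False by simp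
  qed
qed simp

text \<open>Each term acquires the factor \<open>- (n + k)\<close>. The part with \<open>n\<close>
  restores the sum at index \<open>n - 1\<close>; the part with \<open>k\<close> cancels into
  \<open>1 / fact k\<close>, and moving \<open>k\<close> by one turns it into \<open>d\<close> of
  the sum at \<open>n\<close>.\<close>

lemma skew_sum_left_shift:
  assumes f: "\<And>m. m \<ge> B \<Longrightarrow> f m = 0"
  shows "skew_sum (left_shift f) = right_shift (skew_sum f)"
proof
  fix n
  let ?c = "\<lambda>n k. (- 1) ^ Suc (n + k) / fact k :: complex"
  have Tf: "left_shift f m = 0" if "m \<ge> Suc B" for m
    using that f[of "m - 1"] by (simp add: left_shift_def)
  \<comment> \<open>At \<open>n = 0\<close> the truncated index \<open>n - 1\<close> is harmless,
    since its term carries the factor \<open>of_nat n\<close>.\<close>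
  have summand: "scale (?c n k) ((d ^^ k) (left_shift f (n + k))) =
    scale (of_nat n) (scale (?c (n - 1) k) ((d ^^ k) (f (n - 1 + k)))) +
    scale (- of_nat k * ?c n k) ((d ^^ k) (f (n + k - 1)))" for k
    by (cases n) (simp_all add: left_shift_def dpow_minus dpow_diff dpow_add dpow_scale
        add_divide_distrib diff_divide_distrib algebra_simps)
  have "skew_sum (left_shift f) n = (\<Sum>k<Suc B. scale (?c n k) ((d ^^ k) (left_shift f (n + k))))"
    by (rule skew_sum_eq[OF Tf]) auto
  also have "\<dots> = scale (of_nat n) (\<Sum>k<Suc B. scale (?c (n - 1) k) ((d ^^ k) (f (n - 1 + k)))) +
     (\<Sum>k<Suc B. scale (- of_nat k * ?c n k) ((d ^^ k) (f (n + k - 1))))"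
    unfolding summand sum.distrib scale_sum_right ..
  also have "(\<Sum>k<Suc B. scale (?c (n - 1) k) ((d ^^ k) (f (n - 1 + k)))) = skew_sum f (n - 1)"
    by (rule skew_sum_eq[OF f, symmetric]) auto
  also have "(\<Sum>k<Suc B. scale (- of_nat k * ?c n k) ((d ^^ k) (f (n + k - 1)))) =
     (\<Sum>k<B. scale (?c n k) (d ((d ^^ k) (f (n + k)))))"
    by (subst sum.lessThan_Suc_shift) (simp add: field_simps del: of_nat_Suc)
  also have "\<dots> = d (skew_sum f n)"
    by (subst skew_sum_eq[OF f order_refl]) (simp_all add: D.sum D.scale D.neg)
  finally show "skew_sum (left_shift f) n = right_shift (skew_sum f) n"
    by (simp add: right_shift_def)
qed

text \<open>Now the part with \<open>k\<close>, after moving \<open>k\<close> by one, cancels the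
  terms with one more \<open>d\<close>, and only the part with \<open>n\<close> survives. The two
  cancelling ranges differ by \<open>k = B\<close>, where \<open>f (n + B) = 0\<close>.\<close>

lemma skew_sum_right_shift:
  assumes f: "\<And>m. m \<ge> B \<Longrightarrow> f m = 0"
  shows "skew_sum (right_shift f) = left_shift (skew_sum f)"
proof
  fix n
  let ?c = "\<lambda>n k. (- 1) ^ Suc (n + k) / fact k :: complex"
  have Df: "right_shift f m = 0" if "m \<ge> Suc B" for m
    using that f[of "m - 1"] f[of m] by (simp add: right_shift_def D.zero)
  have summand: "scale (?c n k) ((d ^^ k) (right_shift f (n + k))) =
    scale (- of_nat n) (scale (?c (n - 1) k) ((d ^^ k) (f (n - 1 + k)))) +
    scale (of_nat k * ?c n k) ((d ^^ k) (f (n + k - 1))) +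
    scale (?c n k) (d ((d ^^ k) (f (n + k))))" for k
    by (cases n) (simp_all add: right_shift_def dpow_add dpow_scale funpow_swap1
        add_divide_distrib diff_divide_distrib algebra_simps)
  have "skew_sum (right_shift f) n = (\<Sum>k<Suc B. scale (?c n k) ((d ^^ k) (right_shift f (n + k))))"
    by (rule skew_sum_eq[OF Df]) auto
  also have "\<dots> = scale (- of_nat n) (\<Sum>k<Suc B. scale (?c (n - 1) k) ((d ^^ k) (f (n - 1 + k)))) +
     (\<Sum>k<Suc B. scale (of_nat k * ?c n k) ((d ^^ k) (f (n + k - 1)))) +
     (\<Sum>k<Suc B. scale (?c n k) (d ((d ^^ k) (f (n + k)))))"
    unfolding summand sum.distrib scale_sum_right ..
  also have "(\<Sum>k<Suc B. scale (?c (n - 1) k) ((d ^^ k) (f (n - 1 + k)))) = skew_sum f (n - 1)"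
    by (rule skew_sum_eq[OF f, symmetric]) auto
  also have "(\<Sum>k<Suc B. scale (of_nat k * ?c n k) ((d ^^ k) (f (n + k - 1)))) =
     - (\<Sum>k<B. scale (?c n k) (d ((d ^^ k) (f (n + k)))))"
    by (subst sum.lessThan_Suc_shift) (simp add: field_simps sum_negf[symmetric] del: of_nat_Suc)
  finally show "skew_sum (right_shift f) n = left_shift (skew_sum f) n"
    by (simp add: left_shift_def f D.zero)
qed

lemma skew_sum_add:
  assumes f: "\<And>m. m \<ge> B \<Longrightarrow> f m = 0" and g: "\<And>m. m \<ge> C \<Longrightarrow> g m = 0"
  shows "skew_sum (\<lambda>n. f n + g n) n = skew_sum f n + skew_sum g n"
proof -
  let ?N = "max B C"
  have "skew_sum (\<lambda>n. f n + g n) n =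
      (\<Sum>k<?N. scale ((- 1) ^ Suc (n + k) / fact k) ((d ^^ k) (f (n + k) + g (n + k))))"
    by (rule skew_sum_eq[of ?N]) (simp_all add: f g)
  then show ?thesis
    by (simp add: skew_sum_eq[of B f ?N, OF f] skew_sum_eq[of C g ?N, OF g] dpow_add
        scale_right_distrib sum.distrib del: power_Suc)
qed

lemma left_shift_add: "left_shift (\<lambda>n. f n + g n) = (\<lambda>n. left_shift f n + left_shift g n)"
  by (simp add: left_shift_def fun_eq_iff scale_right_distrib)

lemma right_shift_add: "right_shift (\<lambda>n. f n + g n) = (\<lambda>n. right_shift f n + right_shift g n)"
  by (simp add: right_shift_def fun_eq_iff scale_right_distrib D.add)

lemma left_shift_zero [simp]: "left_shift (\<lambda>_. 0) = (\<lambda>_. 0)"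
  by (simp add: left_shift_def fun_eq_iff)

lemma right_shift_zero [simp]: "right_shift (\<lambda>_. 0) = (\<lambda>_. 0)"
  by (simp add: right_shift_def fun_eq_iff D.zero)

text \<open>Lets the rule for \<partial> in the right argument survive an extension in the left
  argument; see \<open>ext_prod_del_right\<close>.\<close>

lemma left_right_shift: "left_shift (right_shift f) = right_shift (left_shift f)"
proof
  fix n show "left_shift (right_shift f) n = right_shift (left_shift f) n"
    by (simp add: left_shift_def right_shift_def D.neg D.scale scale_right_distrib mult.commute)
qed

lemma left_shift_scale: "left_shift (\<lambda>n. scale c (f n)) = (\<lambda>n. scale c (left_shift f n))"
  by (simp add: left_shift_def fun_eq_iff mult.commute)

lemma right_shift_scale: "right_shift (\<lambda>n. scale c (f n)) = (\<lambda>n. scale c (right_shift f n))"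
  by (simp add: right_shift_def fun_eq_iff mult.commute D.scale scale_right_distrib)

end

text \<open>\<open>P u v n\<close> is the \<open>n\<close>-th product \<open>u\<^sub>(\<^sub>n\<^sub>) v\<close>, the coefficient of \<open>z\<^sup>-\<^sup>n\<^sup>-\<^sup>1\<close> in \<open>Y\<^sup>+(u,z)v\<close>.\<close>

locale n_products = del_module scale d
  for scale :: "complex \<Rightarrow> 'r::ab_group_add \<Rightarrow> 'r" and d +
  fixes P :: "'r \<Rightarrow> 'r \<Rightarrow> nat \<Rightarrow> 'r"
  assumes P_bilinear: "bilinear_op scale (\<lambda>u v. P u v n)"
    and P_finite: "\<exists>B. \<forall>n\<ge>B. P u v n = 0"
    and P_left: "P (d u) v = left_shift (P u v)"
begin

lemma P_add_left: "P (u + u') v n = P u v n + P u' v n"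
  and P_add_right: "P u (v + v') n = P u v n + P u v' n"
  and P_scale_left: "P (scale c u) v n = scale c (P u v n)"
  and P_scale_right: "P u (scale c v) n = scale c (P u v n)"
  using P_bilinear[of n] by (auto simp: bilinear_op_def Vector_Spaces.linear_iff)

lemma P_add_left_fun: "P (u + u') v = (\<lambda>n. P u v n + P u' v n)"
  and P_add_right_fun: "P u (v + v') = (\<lambda>n. P u v n + P u v' n)"
  by (simp_all add: fun_eq_iff P_add_left P_add_right)

lemma P_zero_left [simp]: "P 0 v n = 0"
  using P_add_left[of 0 0 v n] by simp

lemma P_zero_right [simp]: "P u 0 n = 0"
  using P_add_right[of u 0 0 n] by simp

lemma P_minus_left: "P (- u) v n = - P u v n"
  using P_add_left[of u "- u" v n] by (simp add: eq_neg_iff_add_eq_0 add.commute)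

lemma P_minus_right: "P u (- v) n = - P u v n"
  using P_add_right[of u v "- v" n] by (simp add: eq_neg_iff_add_eq_0 add.commute)

lemma P_diff_left: "P (u - u') v n = P u v n - P u' v n"
  using P_add_left[of u "- u'" v n] by (simp add: P_minus_left)

lemma P_left_nth: "P (d u) v n = - scale (of_nat n) (P u v (n - 1))"
  by (simp add: P_left left_shift_def)

section \<open>Skew-symmetry and Borcherds' identity under sums and \<partial>\<close>

definition skew :: "complex \<Rightarrow> 'r \<Rightarrow> 'r \<Rightarrow> bool" where
  "skew s u v \<longleftrightarrow> P u v = (\<lambda>n. scale s (skew_sum (P v u) n))"

text \<open>Skew-symmetry trades \<open>P u (d v)\<close> for \<open>P (d v) u\<close>, where the
  left rule applies, and \<open>skew_sum\<close> turns \<open>left_shift\<close> into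
  \<open>right_shift\<close>. The sign \<open>s\<close> is a parameter because no grading is present
  yet.\<close>

lemma P_right_if_skew:
  assumes "skew s u v" "skew s u (d v)"
  shows "P u (d v) = right_shift (P u v)"
proof -
  obtain B where B: "\<And>n. n \<ge> B \<Longrightarrow> P v u n = 0"
    using P_finite by blast
  have "P u (d v) = (\<lambda>n. scale s (skew_sum (left_shift (P v u)) n))"
    using assms(2) by (simp add: skew_def P_left)
  also have "\<dots> = right_shift (P u v)"
    by (simp add: skew_sum_left_shift[OF B] assms(1)[unfolded skew_def] right_shift_scale)
  finally show ?thesis .
qed

text \<open>The same computation read backwards: once the right rule is known, skew-symmetry passes
  from \<open>v\<close> to \<open>d v\<close>.\<close>

lemma skew_del_right:
  assumes "skew s u v" "P u (d v) = right_shift (P u v)"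
  shows "skew s u (d v)"
proof -
  obtain B where B: "\<And>n. n \<ge> B \<Longrightarrow> P v u n = 0"
    using P_finite by blast
  show ?thesis
    using assms(2) unfolding skew_def P_left
    by (simp add: skew_sum_left_shift[OF B] assms(1)[unfolded skew_def] right_shift_scale)
qed

lemma skew_del_left:
  assumes "skew s u v" "P v (d u) = right_shift (P v u)"
  shows "skew s (d u) v"
proof -
  obtain B where B: "\<And>n. n \<ge> B \<Longrightarrow> P v u n = 0"
    using P_finite by blast
  show ?thesis
    unfolding skew_def P_left
    by (simp add: assms(2) skew_sum_right_shift[OF B] assms(1)[unfolded skew_def] left_shift_scale)
qed

lemma skew_add_left:
  assumes "skew s u v" "skew s u' v"
  shows "skew s (u + u') v"
proof -
  obtain B B' where "\<And>n. n \<ge> B \<Longrightarrow> P v u n = 0" "\<And>n. n \<ge> B' \<Longrightarrow> P v u' n = 0"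
    using P_finite by meson
  then show ?thesis
    using assms unfolding skew_def
    by (simp add: P_add_left P_add_right_fun skew_sum_add[of B "P v u" B' "P v u'"]
        scale_right_distrib fun_eq_iff)
qed

lemma skew_add_right:
  assumes "skew s u v" "skew s u v'"
  shows "skew s u (v + v')"
proof -
  obtain B B' where "\<And>n. n \<ge> B \<Longrightarrow> P v u n = 0" "\<And>n. n \<ge> B' \<Longrightarrow> P v' u n = 0"
    using P_finite by meson
  then show ?thesis
    using assms unfolding skew_def
    by (simp add: P_add_right P_add_left_fun skew_sum_add[of B "P v u" B' "P v' u"]
        scale_right_distrib fun_eq_iff)
qed

text \<open>The difference of the two sides, rather than the equation, so that sums and \<partial>
  act on it by exact formulas. The truncated \<open>m - l\<close> is a true difference since
  \<open>l \<le> m\<close>.\<close>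

definition jacobi_defect :: "complex \<Rightarrow> 'r \<Rightarrow> 'r \<Rightarrow> 'r \<Rightarrow> nat \<Rightarrow> nat \<Rightarrow> 'r" where
  "jacobi_defect s u v w m n = P u (P v w n) m - scale s (P v (P u w m) n)
     - (\<Sum>l\<le>m. scale (of_nat (m choose l)) (P (P u v (m - l)) w (n + l)))"

lemma jacobi_defect_add_1: "jacobi_defect s (u + u') v w m n = jacobi_defect s u v w m n +
    jacobi_defect s u' v w m n"
  by (simp add: jacobi_defect_def P_add_left P_add_right scale_right_distrib sum.distrib algebra_simps)

lemma jacobi_defect_add_2: "jacobi_defect s u (v + v') w m n = jacobi_defect s u v w m n +
    jacobi_defect s u v' w m n"
  by (simp add: jacobi_defect_def P_add_left P_add_right scale_right_distrib sum.distrib algebra_simps)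

lemma jacobi_defect_add_3: "jacobi_defect s u v (w + w') m n = jacobi_defect s u v w m n +
    jacobi_defect s u v w' m n"
  by (simp add: jacobi_defect_def P_add_left P_add_right scale_right_distrib sum.distrib algebra_simps)

text \<open>By absorption, \<open>(m - l) * (m choose l) = m * ((m - 1) choose l)\<close>, so the
  factor \<open>m - l\<close> that \<partial> produces lowers \<open>m\<close> by one.\<close>

lemma jacobi_defect_del_1:
  "jacobi_defect s (d u) v w m n = - scale (of_nat m) (jacobi_defect s u v w (m - 1) n)"
proof (cases m)
  case 0
  then show ?thesis
    by (simp add: jacobi_defect_def P_left_nth)
next
  case (Suc k)
  have "(\<Sum>l\<le>m. scale (of_nat (m choose l)) (P (P (d u) v (m - l)) w (n + l))) =
        (\<Sum>l\<le>m. - scale (of_nat ((m - l) * (m choose l))) (P (P u v (k - l)) w (n + l)))"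
    by (rule sum.cong) (simp_all add: Suc P_left_nth P_minus_left P_scale_left mult.commute)
  also have "\<dots> = (\<Sum>l\<le>m. - scale (of_nat (m * (k choose l))) (P (P u v (k - l)) w (n + l)))"
    by (rule sum.cong) (simp_all only: Suc binomial_absorb_comp diff_Suc_1)
  \<comment> \<open>The term \<open>l = m\<close> drops out because
    \<open>k choose Suc k = 0\<close>.\<close>
  also have "\<dots> = (\<Sum>l\<le>k. - scale (of_nat (m * (k choose l))) (P (P u v (k - l)) w (n + l)))"
    by (simp add: Suc binomial_eq_0)
  also have "\<dots> = - scale (of_nat m) (\<Sum>l\<le>k. scale (of_nat (k choose l)) (P (P u v (k - l)) w (n + l)))"
    by (simp add: scale_sum_right sum_negf)
  finally show ?thesis
    by (simp add: jacobi_defect_def P_left_nth P_minus_right P_scale_right Suc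
        scale_right_diff_distrib mult.commute)
qed

text \<open>In the sum, \<partial> yields the factor \<open>- (n + l)\<close> from the outer product
  and \<open>m - l\<close> from the inner one. The contributions of \<open>l\<close> and
  \<open>m - l\<close> cancel, which leaves the factor \<open>- n\<close>.\<close>

lemma jacobi_defect_del_2:
  assumes R: "\<And>x. P u (d x) = right_shift (P u x)"
  shows "jacobi_defect s u (d v) w m n = - scale (of_nat n) (jacobi_defect s u v w m (n - 1))"
proof -
  let ?g = "\<lambda>l. scale (of_nat (l * (m choose l))) (P (P u v (m - l)) w (n + l - 1))"
  have "(\<Sum>l\<le>m. scale (of_nat (m choose l)) (P (P u (d v) (m - l)) w (n + l))) =
     (\<Sum>l\<le>m. - scale (of_nat n) (scale (of_nat (m choose l)) (P (P u v (m - l)) w (n - 1 + l)))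
       - ?g l + scale (of_nat ((m - l) * (m choose l))) (P (P u v (m - l - 1)) w (n + l)))"
    by (rule sum.cong, simp, cases n)
       (simp_all add: R right_shift_def P_left_nth P_minus_left P_diff_left P_scale_left P_add_left
          of_nat_diff algebra_simps)
  also have "\<dots> = - scale (of_nat n) (\<Sum>l\<le>m. scale (of_nat (m choose l)) (P (P u v (m - l)) w (n - 1 +
      l)))
       - (\<Sum>l\<le>m. ?g l) + (\<Sum>l\<le>m. scale (of_nat ((m - l) * (m choose l))) (P (P u v (m - l - 1)) w (n +
           l)))"
    by (simp add: sum.distrib sum_subtractf sum_negf scale_sum_right)
  \<comment> \<open>The cancellation: replace \<open>l\<close> by \<open>l + 1\<close> using
    \<open>(m - l) * (m choose l) = (l + 1) * (m choose (l + 1))\<close>.\<close>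
  also have "(\<Sum>l\<le>m. scale (of_nat ((m - l) * (m choose l))) (P (P u v (m - l - 1)) w (n + l))) =
      (\<Sum>l\<le>m. ?g l)"
  proof (cases m)
    case (Suc k)
    have "(\<Sum>l\<le>Suc k. scale (of_nat ((Suc k - l) * (Suc k choose l))) (P (P u v (Suc k - l - 1)) w (n
        + l)))
        = (\<Sum>l\<le>k. scale (of_nat ((Suc k - l) * (Suc k choose l))) (P (P u v (Suc k - l - 1)) w (n + l)))"
      by simp
    also have "\<dots> = (\<Sum>l\<le>k. scale (of_nat (Suc l * (Suc k choose Suc l))) (P (P u v (k - l)) w (n + l)))"
      by (rule sum.cong, simp) (simp only: binomial_absorb_comp Suc_times_binomial diff_Suc_1
        diff_commute[of "Suc k" _ 1])
    also have "\<dots> = (\<Sum>l\<le>Suc k. scale (of_nat (l * (Suc k choose l))) (P (P u v (Suc k - l)) w (n + l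
        - 1)))"
      by (subst sum.atMost_Suc_shift) simp
    finally show ?thesis
      by (simp only: Suc)
  qed simp
  finally show ?thesis
    by (simp add: jacobi_defect_def R right_shift_def P_left_nth P_minus_right P_scale_right
        algebra_simps scale_right_diff_distrib)
qed

text \<open>The right rule gives \<open>d\<close> of the defect plus terms of lowered index; the
  factor \<open>n + l\<close> splits, and
  \<open>l * (m choose l) = m * ((m - 1) choose (l - 1))\<close>. Because indices are lowered,
  vanishing has to be propagated for all \<open>m\<close> and \<open>n\<close> at once.\<close>

lemma jacobi_defect_del_3:
  assumes R: "\<And>u x. u \<in> {a, b} \<or> u \<in> range (P a b) \<Longrightarrow> P u (d x) = right_shift (P u x)"
  shows "jacobi_defect s a b (d w) m n = d (jacobi_defect s a b w m n)
     + scale (of_nat m) (jacobi_defect s a b w (m - 1) n)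
     + scale (of_nat n) (jacobi_defect s a b w m (n - 1))"
proof -
  have "(\<Sum>l\<le>m. scale (of_nat (m choose l)) (P (P a b (m - l)) (d w) (n + l))) =
    (\<Sum>l\<le>m. d (scale (of_nat (m choose l)) (P (P a b (m - l)) w (n + l)))
      + scale (of_nat n) (scale (of_nat (m choose l)) (P (P a b (m - l)) w (n - 1 + l)))
      + scale (of_nat (l * (m choose l))) (P (P a b (m - l)) w (n + l - 1)))"
    by (rule sum.cong, simp, cases n)
       (simp_all add: R right_shift_def D.scale algebra_simps)
  also have "\<dots> = d (\<Sum>l\<le>m. scale (of_nat (m choose l)) (P (P a b (m - l)) w (n + l)))
      + scale (of_nat n) (\<Sum>l\<le>m. scale (of_nat (m choose l)) (P (P a b (m - l)) w (n - 1 + l)))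
      + (\<Sum>l\<le>m. scale (of_nat (l * (m choose l))) (P (P a b (m - l)) w (n + l - 1)))"
    by (simp add: sum.distrib scale_sum_right D.sum)
  also have "(\<Sum>l\<le>m. scale (of_nat (l * (m choose l))) (P (P a b (m - l)) w (n + l - 1))) =
     scale (of_nat m) (\<Sum>l\<le>m - 1. scale (of_nat ((m - 1) choose l)) (P (P a b (m - 1 - l)) w (n + l)))"
  proof (cases m)
    case (Suc k)
    show ?thesis unfolding Suc
      by (subst sum.atMost_Suc_shift)
        (simp add: scale_sum_right Suc_times_binomial
           del: of_nat_Suc of_nat_mult binomial_Suc_Suc mult_Suc_right mult_Suc
           add: of_nat_mult[symmetric])
  qed simp
  finally show ?thesis
    by (simp add: jacobi_defect_def R right_shift_def P_add_right P_scale_right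
        algebra_simps scale_right_diff_distrib scale_right_distrib D.diff D.add D.scale)
qed

end

section \<open>Translation of the axioms to \<open>n\<close>-th products\<close>

definition pole_coeff :: "(int \<Rightarrow> 'r) \<Rightarrow> nat \<Rightarrow> 'r" where
  "pole_coeff f n = f (- 1 - int n)"

definition pole_series :: "(nat \<Rightarrow> 'r::zero) \<Rightarrow> int \<Rightarrow> 'r" where
  "pole_series f k = (if k < 0 then f (nat (- 1 - k)) else 0)"

lemma pole_series_nth: "pole_series f (- 1 - int n) = f n"
  by (simp add: pole_series_def)

lemma pole_coeff_series [simp]: "pole_coeff (pole_series f) = f"
  by (simp add: pole_coeff_def pole_series_def fun_eq_iff)

lemma pole_series_coeff:
  assumes "polar_part f" shows "pole_series (pole_coeff f) = f"
  using assms by (auto simp: polar_part_def pole_coeff_def pole_series_def fun_eq_iff)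

lemma polar_part_pole_series:
  assumes "\<And>n. n \<ge> B \<Longrightarrow> f n = 0"
  shows "polar_part (pole_series f)"
proof -
  have "{k. pole_series f k \<noteq> 0} \<subseteq> {- int B..0}"
  proof
    fix k assume "k \<in> {k. pole_series f k \<noteq> 0}"
    then have "k < 0" "\<not> B \<le> nat (- 1 - k)"
      using assms by (auto simp: pole_series_def split: if_splits)
    then show "k \<in> {- int B..0}" by auto
  qed
  then show ?thesis
    unfolding polar_part_def using finite_subset[of _ "{- int B..0}"]
    by (auto simp: pole_series_def)
qed

lemma pole_coeff_finite:
  assumes "polar_part f" shows "\<exists>B. \<forall>n\<ge>B. pole_coeff f n = 0"
proof -
  have fin: "finite {n. f n \<noteq> 0}"
    using assms by (simp add: polar_part_def)
  obtain b where b: "\<And>n. f n \<noteq> 0 \<Longrightarrow> b \<le> n"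
    using bdd_below_finite[OF fin] by (auto simp: bdd_below_def)
  have "pole_coeff f n = 0" if "n \<ge> nat (- b)" for n
    unfolding pole_coeff_def by (rule ccontr, drule b) (use that in linarith)
  then show ?thesis by blast
qed

text \<open>These are the coefficients of the geometric series \<open>(z - x)^(-1)\<close>.\<close>

lemma neg_one_gchoose: "((- 1) ^ n * (- 1 gchoose n) :: complex) = 1"
  by (simp add: gbinomial_minus[of 1] binomial_gbinomial[symmetric] power_mult_distrib[symmetric])

text \<open>Upper negation, for the coefficients of \<open>(z - x)^(-j-1)\<close>.\<close>

lemma neg_gchoose: "((- 1) ^ l * ((- of_nat j - 1) gchoose l) :: complex) = of_nat ((j + l) choose l)"
proof -
  have "((- of_nat j - 1 :: complex) gchoose l) = (- 1) ^ l * (of_nat (j + l) gchoose l)"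
  proof -
    have "(- of_nat j - 1 :: complex) = - (of_nat j + 1)"
      by simp
    then show ?thesis
      by (simp only: gbinomial_minus) simp
  qed
  then show ?thesis
    by (simp add: binomial_gbinomial power_mult_distrib[symmetric] flip: mult.assoc)
qed

context del_module begin

text \<open>Since \<open>(z - x)^(-1)\<close> is a geometric series in nonnegative powers of
  \<open>x\<close>, this residue renames \<open>x\<close> to \<open>z\<close> and projects onto the
  negative powers.\<close>

lemma Res_mult_binom:
  "Res (mult_binom scale (- 1) f m) = (if m < 0 then f m else 0)"
proof -
  have "scale (binom_series (- 1) m l) (f (- 1 - l)) = (if l = - 1 - m then (if m < 0 then f m else
      0) else 0)" for l
    using neg_one_gchoose[of "nat l"] by (auto simp: binom_series_def)
  then show ?thesis
    by (simp add: Res_def mult_binom_def)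
qed

text \<open>The sign of \<open>f(-x)\<close> at the exponent \<open>- 1 - n - k\<close> is
  \<open>(- 1) ^ Suc (n + k)\<close>, which is the sign built into \<open>skew_sum\<close>.\<close>

lemma exp_act_neg_arg:
  "exp_act scale d (neg_arg scale f) (- 1 - int n) = skew_sum (pole_coeff f) n"
proof -
  have "(- 1 :: complex) powi (- 1 - int n - int k) = (- 1) ^ Suc (n + k)" for k
  proof -
    have "- 1 - int n - int k = - int (Suc (n + k))" by simp
    then show ?thesis
      by (simp only: power_int_minus power_int_of_nat) (simp flip: power_inverse)
  qed
  then show ?thesis
    by (simp add: exp_act_def neg_arg_def skew_sum_def pole_coeff_def dpow_scale algebra_simps)
qed

lemma Res_skew:
  "(\<lambda>m. scale s (Res (mult_binom scale (- 1) (exp_act scale d (neg_arg scale f)) m))) =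
     pole_series (\<lambda>n. scale s (skew_sum (pole_coeff f) n))"
proof
  fix m :: int
  have "m = - 1 - int (nat (- 1 - m))" if "m < 0"
    using that by simp
  then show "scale s (Res (mult_binom scale (- 1) (exp_act scale d (neg_arg scale f)) m)) =
     pole_series (\<lambda>n. scale s (skew_sum (pole_coeff f) n)) m"
    by (auto simp: Res_mult_binom pole_series_def simp flip: exp_act_neg_arg)
qed

text \<open>Only the power \<open>k = m + l\<close> of \<open>f\<close> contributes to
  \<open>z^m x^l\<close>. Polarity forces \<open>k < 0\<close>, which is the bound
  \<open>l \<le> - 1 - m\<close>.\<close>

lemma subst_diff_coeff:
  assumes "polar_part f"
  shows "subst_diff scale f m l = (if m < 0 \<and> 0 \<le> l \<and> l \<le> - 1 - m
     then scale (of_nat (nat (- 1 - m) choose nat l)) (f (m + l)) else 0)"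
proof -
  have "scale (binom_series k m l) (f k) = (if k = m + l then (if m < 0 \<and> 0 \<le> l \<and> l \<le> - 1 - m
     then scale (of_nat (nat (- 1 - m) choose nat l)) (f (m + l)) else 0) else 0)" for k
  proof (cases "k = m + l \<and> l \<ge> 0")
    case True
    show ?thesis
    proof (cases "k < 0")
      case False
      then have "f k = 0" using assms by (simp add: polar_part_def)
      with False True show ?thesis by auto
    next
      case neg: True
      \<comment> \<open>With \<open>k = - j - 1\<close> the coefficient takes the form treated in
        \<open>neg_gchoose\<close>.\<close>
      define j where "j = nat (- 1 - k)"
      have j: "of_int k = (- of_nat j - 1 :: complex)" "nat (- 1 - m) = j + nat l"
        using neg True by (auto simp: j_def)
      have "binom_series k m l = of_nat (j + nat l choose nat l)"
        using True neg_gchoose[of "nat l" j] unfolding binom_series_def j(1) by auto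
      then show ?thesis
        using neg True by (auto simp: j(2))
    qed
  qed (auto simp: binom_series_def)
  then show ?thesis
    by (simp add: subst_diff_def)
qed

text \<open>For \<open>m = - 1 - p\<close> and \<open>n = - 1 - q\<close> the result is the right
  side of Borcherds' identity at the indices \<open>p\<close> and \<open>q\<close>: the residue
  removes the exponents \<open>n \<ge> 0\<close>, and polarity makes the sum over \<open>l\<close>
  finite.\<close>

lemma Res_commutator:
  assumes "polar_part (Y u v)" and pol: "\<And>a. polar_part (Y a w)" and zero: "Y 0 w = (\<lambda>_. 0)"
    and Y_scale: "\<And>c a n. Y (scale c a) w n = scale c (Y a w n)"
  shows "Res (mult_binom scale (- 1) (Y_series Y (subst_diff scale (Y u v) m) w) n) =
    (if m < 0 \<and> n < 0 then
       \<Sum>l\<le>nat (- 1 - m). scale (of_nat (nat (- 1 - m) choose l)) (Y (Y u v (m + int l)) w (n - int l))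
     else 0)"
proof -
  let ?M = "nat (- 1 - m)"
  let ?g = "\<lambda>l. Y (subst_diff scale (Y u v) m l) w (n - l)"
  have g: "?g l = (if m < 0 \<and> 0 \<le> l \<and> l \<le> - 1 - m then
      scale (of_nat (?M choose nat l)) (Y (Y u v (m + l)) w (n - l)) else 0)" for l
    by (simp add: subst_diff_coeff[OF assms(1)] Y_scale zero)
  have "Sum_any ?g = (\<Sum>l\<in>int ` {..?M}. ?g l)"
  proof (rule Sum_any.expand_superset)
    show "{l. ?g l \<noteq> 0} \<subseteq> int ` {..?M}"
    proof
      fix l assume "l \<in> {l. ?g l \<noteq> 0}"
      then have "0 \<le> l \<and> l \<le> - 1 - m"
        unfolding g by (auto split: if_splits)
      then show "l \<in> int ` {..?M}"
        by (intro image_eqI[of _ _ "nat l"]) auto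
    qed
  qed simp
  also have "\<dots> = (\<Sum>l\<le>?M. ?g (int l))"
    by (simp add: sum.reindex)
  also have "\<dots> = (if m < 0 then \<Sum>l\<le>?M. scale (of_nat (?M choose l)) (Y (Y u v (m + int l)) w (n -
      int l)) else 0)"
    by (cases "m < 0") (auto simp: g subst_diff_coeff[OF assms(1)] zero Y_scale intro!: sum.cong)
  finally show ?thesis
    by (simp add: Res_mult_binom Y_series_def)
qed

end

section \<open>Equivalence of the conformal axioms with the product identities\<close>

lemma conformal_n_products:
  assumes "conformal_superalgebra scale R d Y"
  shows "n_products scale d (\<lambda>u v. pole_coeff (Y u v))"
proof -
  interpret conformal_superalgebra scale R d Y by fact
  interpret dm: del_module scale d
    by (simp add: del_module_def del_module_axioms_def d_linear vector_space_axioms)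
  show ?thesis
  proof
    show "bilinear_op scale (\<lambda>u v. pole_coeff (Y u v) n)" for n
      using Y_bilinear[of "- 1 - int n"] by (simp add: pole_coeff_def)
    show "\<exists>B. \<forall>n\<ge>B. pole_coeff (Y u v) n = 0" for u v
      using Y_polar by (rule pole_coeff_finite)
    have "pole_coeff (Y (d u) v) n = dm.left_shift (pole_coeff (Y u v)) n" for u v n
      by (cases n) (simp_all add: Y_deriv fderiv_def dm.left_shift_def pole_coeff_def flip:
          scale_minus_left)
    then show "pole_coeff (Y (d u) v) = dm.left_shift (pole_coeff (Y u v))" for u v
      by blast
  qed
qed

lemma conformal_skew:
  assumes "conformal_superalgebra scale R d Y" "u \<in> R i" "v \<in> R j"
  shows "n_products.skew scale d (\<lambda>u v. pole_coeff (Y u v)) (parity_sign i j) u v"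
proof -
  interpret conformal_superalgebra scale R d Y by fact
  interpret n_products scale d "\<lambda>u v. pole_coeff (Y u v)"
    by (rule conformal_n_products) fact
  show ?thesis
    using Y_skew[OF assms(2,3)] unfolding skew_def Res_skew by simp
qed

lemma conformal_jacobi:
  assumes "conformal_superalgebra scale R d Y" "u \<in> R i" "v \<in> R j"
  shows "n_products.jacobi_defect scale (\<lambda>u v. pole_coeff (Y u v)) (parity_sign i j) u v w m n = 0"
proof -
  interpret conformal_superalgebra scale R d Y by fact
  interpret n_products scale d "\<lambda>u v. pole_coeff (Y u v)"
    by (rule conformal_n_products) fact
  have lin: "Y (a + b) w k = Y a w k + Y b w k" "Y (scale c a) w k = scale c (Y a w k)" for a b c k
    using Y_bilinear[of k] by (auto simp: bilinear_op_def Vector_Spaces.linear_iff)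
  have zero: "Y 0 w = (\<lambda>_. 0)"
    using lin(2)[of 0] by (simp add: fun_eq_iff)
  have "(\<Sum>l\<le>m. scale (of_nat (m choose l)) (Y (Y u v (- 1 - int m + int l)) w (- 1 - int n - int l)))
      = (\<Sum>l\<le>m. scale (of_nat (m choose l)) (Y (Y u v (- 1 - int (m - l))) w (- 1 - int (n + l))))"
  proof (rule sum.cong)
    fix l assume "l \<in> {..m}"
    then have "- 1 - int m + int l = - 1 - int (m - l)" "- 1 - int n - int l = - 1 - int (n + l)"
      by auto
    then show "scale (of_nat (m choose l)) (Y (Y u v (- 1 - int m + int l)) w (- 1 - int n - int l)) =
      scale (of_nat (m choose l)) (Y (Y u v (- 1 - int (m - l))) w (- 1 - int (n + l)))"
      by (simp only:)
  qed simp
  then show ?thesis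
    using Y_commutator[OF assms(2,3), of w "- 1 - int n" "- 1 - int m"]
    unfolding Res_commutator[where Y=Y, OF Y_polar Y_polar zero lin(2)] jacobi_defect_def pole_coeff_def
    by simp
qed

text \<open>Converse of the three preceding translations. At nonnegative exponents both sides of
  each axiom vanish, so the product identities supply the rest.\<close>

lemma (in n_products) conformal_superalgebra_pole_series:
  assumes "superspace scale R"
    and d_graded: "\<And>u i. u \<in> R i \<Longrightarrow> d u \<in> R i"
    and graded: "\<And>n. graded_op R (\<lambda>u v. P u v n)"
    and sk: "\<And>u v i j. u \<in> R i \<Longrightarrow> v \<in> R j \<Longrightarrow> skew (parity_sign i j) u v"
    and jac: "\<And>u v w i j m n. u \<in> R i \<Longrightarrow> v \<in> R j \<Longrightarrow> jacobi_defect (parity_sign i j) u v w m n = 0"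
  shows "conformal_superalgebra scale R d (\<lambda>u v. pole_series (P u v))"
proof -
  interpret superspace scale R by fact
  have pol: "polar_part (pole_series (P u v))" for u v
    using P_finite[of u v] polar_part_pole_series by blast
  show ?thesis
  proof (intro conformal_superalgebra.intro conformal_superalgebra_axioms.intro)
    show "superspace scale R" by fact
    show "Vector_Spaces.linear scale scale d" by (rule d_linear)
    show "d u \<in> R i" if "u \<in> R i" for u i using that by (rule d_graded)
    show "bilinear_op scale (\<lambda>u v. pole_series (P u v) n)" for n
      using P_bilinear[of "nat (- 1 - n)"] vector_space_axioms
      by (cases "n < 0") (simp_all add: pole_series_def bilinear_op_def Vector_Spaces.linear_iff)
    show "polar_part (pole_series (P u v))" for u v by (rule pol)
    show "graded_op R (\<lambda>u v. pole_series (P u v) n)" for n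
      using graded[of "nat (- 1 - n)"] subspace_0[OF subspace_G]
      by (cases "n < 0") (simp_all add: pole_series_def graded_op_def)
    show "pole_series (P (d u) v) = fderiv scale (pole_series (P u v))" for u v
    proof
      fix n :: int
      \<comment> \<open>The exponent \<open>- 1\<close> stands apart: a derivative has no
        \<open>z^(-1)\<close> term, which matches the vanishing of the product of index 0 of
        \<open>d u\<close> with \<open>v\<close>.\<close>
      consider "n \<ge> 0" | "n = - 1" | k where "n = - 2 - int k"
        using that(3)[of "nat (- 2 - n)"] that(1,2) by linarith
      then show "pole_series (P (d u) v) n = fderiv scale (pole_series (P u v)) n"
        by cases (simp_all add: pole_series_def fderiv_def P_left_nth nat_add_distrib flip:
            scale_minus_left)
    qed
    show "pole_series (P u v) = (\<lambda>m. scale (parity_sign i j)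
        (Res (mult_binom scale (- 1) (exp_act scale d (neg_arg scale (pole_series (P v u)))) m)))"
      if "u \<in> R i" "v \<in> R j" for u v i j
      using sk[OF that] unfolding Res_skew skew_def pole_coeff_series by (rule arg_cong)
    show "pole_series (P u (pole_series (P v w) n)) m - scale (parity_sign i j) (pole_series (P v
        (pole_series (P u w) m)) n) =
      Res (mult_binom scale (- 1) (Y_series (\<lambda>u v. pole_series (P u v)) (subst_diff scale
          (pole_series (P u v)) m) w) n)"
      if uv: "u \<in> R i" "v \<in> R j" for u v w i j m n
    proof -
      let ?Y = "\<lambda>u v. pole_series (P u v)"
      have zero: "?Y 0 w = (\<lambda>_. 0)"
        by (simp add: pole_series_def fun_eq_iff)
      have sc: "?Y (scale c a) w n = scale c (?Y a w n)" for c a n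
        by (simp add: pole_series_def P_scale_left)
      note comm = Res_commutator[where Y = ?Y, OF pol pol zero sc]
      show ?thesis
      proof (cases "m < 0 \<and> n < 0")
        case True
        define a b where "a = nat (- 1 - m)" and "b = nat (- 1 - n)"
        have mn: "m = - 1 - int a" "n = - 1 - int b"
          using True by (simp_all add: a_def b_def)
        have "P u (P v w b) a - scale (parity_sign i j) (P v (P u w a) b) =
            (\<Sum>l\<le>a. scale (of_nat (a choose l)) (P (P u v (a - l)) w (b + l)))"
          using jac[OF uv, of w a b] unfolding jacobi_defect_def right_minus_eq .
        also have "\<dots> = (\<Sum>l\<le>a. scale (of_nat (a choose l))
            (pole_series (P (pole_series (P u v) (- 1 - int a + int l)) w) (- 1 - int b - int l)))"
        proof (rule sum.cong)
          fix l assume "l \<in> {..a}"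
          then have "- 1 - int a + int l = - 1 - int (a - l)" "- 1 - int b - int l = - 1 - int (b + l)"
            by auto
          then show "scale (of_nat (a choose l)) (P (P u v (a - l)) w (b + l)) = scale (of_nat (a
              choose l))
            (pole_series (P (pole_series (P u v) (- 1 - int a + int l)) w) (- 1 - int b - int l))"
            by (simp only: pole_series_nth)
        qed simp
        finally show ?thesis
          unfolding mn comm pole_series_nth by simp
      next
        case False
        then show ?thesis
          unfolding comm by (auto simp: pole_series_def)
      qed
    qed
  qed
qed

section \<open>Products on the free module\<close>

lemma pCons_free_del: "pCons a p = [:a:] + free_del p"
  for a :: "'v::ab_group_add"
  by (simp add: free_del_def)

text \<open>Horner form: every polynomial arises from constants by sums and \<open>free_del\<close>.
  The set \<open>S\<close> of allowed coefficients is a graded piece for homogeneous elements and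
  \<open>UNIV\<close> otherwise.\<close>

lemma free_module_induct:
  assumes "\<And>n. coeff p n \<in> S"
    and gen: "\<And>a. a \<in> S \<Longrightarrow> Q [:a:]"
    and del: "\<And>p. (\<And>n. coeff p n \<in> S) \<Longrightarrow> Q p \<Longrightarrow> Q (free_del p)"
    and add: "\<And>p q. Q p \<Longrightarrow> Q q \<Longrightarrow> Q (p + q)"
    and "0 \<in> S"
  shows "Q (p :: 'v::ab_group_add poly)"
  using assms(1)
proof (induction p rule: pCons_induct)
  case 0
  then show ?case using gen[OF \<open>0 \<in> S\<close>] by simp
next
  case (pCons a p)
  have "coeff p n \<in> S" for n
    using pCons.prems[of "Suc n"] by simp
  moreover have "a \<in> S"
    using pCons.prems[of 0] by simp
  ultimately show ?case
    unfolding pCons_free_del[of a p] by (intro add del gen pCons.IH)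
qed

section \<open>The free module and the extension of products from its generators\<close>

locale complex_space = vector_space scale
  for scale :: "complex \<Rightarrow> 'v::ab_group_add \<Rightarrow> 'v"
begin

lemma coeff_free_scale: "coeff (free_scale scale c p) n = scale c (coeff p n)"
  by (simp add: free_scale_def coeff_map_poly)

lemma free_scale_pCons: "free_scale scale c (pCons a p) = pCons (scale c a) (free_scale scale c p)"
  by (simp add: free_scale_def map_poly_pCons)

lemma free_scale_0 [simp]: "free_scale scale c 0 = 0"
  by (simp add: free_scale_def)

lemma vector_space_free_scale: "vector_space (free_scale scale)"
  by unfold_locales (simp_all add: poly_eq_iff coeff_free_scale scale_right_distrib scale_left_distrib)

lemma del_module_free: "del_module (free_scale scale) free_del"
  unfolding del_module_def del_module_axioms_def Vector_Spaces.linear_iff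
  by (simp add: vector_space_free_scale free_del_def free_scale_pCons)

end

sublocale superspace \<subseteq> complex_space
  by unfold_locales

lemma (in superspace) superspace_free: "superspace (free_scale scale) (free_grading G)"
proof -
  interpret F: vector_space "free_scale scale" by (rule vector_space_free_scale)
  show ?thesis
  proof
    show "F.subspace (free_grading G i)" for i
      using subspace_G[of i] unfolding F.subspace_def subspace_def
      by (simp add: free_grading_def coeff_free_scale)
    show "free_grading G 0 \<inter> free_grading G 1 = {0}"
    proof -
      have "p = 0" if "\<And>n. coeff p n \<in> G 0" "\<And>n. coeff p n \<in> G 1" for p
        using that G_inter by (auto simp: poly_eq_iff)
      moreover have "0 \<in> G i" for i
        using subspace_G by (rule subspace_0)
      ultimately show ?thesis by (auto simp: free_grading_def)
    qed
    show "\<exists>a\<in>free_grading G 0. \<exists>b\<in>free_grading G 1. v = a + b" for v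
    proof (induction v rule: pCons_induct)
      case 0
      show ?case
        by (intro bexI[of _ 0]) (auto simp: free_grading_def subspace_0[OF subspace_G])
    next
      case (pCons c p)
      then obtain a b where "a \<in> free_grading G 0" "b \<in> free_grading G 1" "p = a + b"
        by blast
      moreover obtain a' b' where "a' \<in> G 0" "b' \<in> G 1" "c = a' + b'"
        using G_sum by blast
      ultimately show ?case
        by (intro bexI[of _ "pCons a' a"] bexI[of _ "pCons b' b"])
          (auto simp: free_grading_def coeff_pCons split: nat.splits)
    qed
  qed
qed

text \<open>Horner's scheme for extending \<open>f\<close> from constants so that \<partial> acts as
  \<open>S\<close>; for additive \<open>S\<close> the value is the sum of the
  \<open>S^n (f a_n)\<close> over the coefficients \<open>a_n\<close>.\<close>

definition shift_extension ::
  "('v \<Rightarrow> nat \<Rightarrow> 'r) \<Rightarrow> ((nat \<Rightarrow> 'r) \<Rightarrow> nat \<Rightarrow> 'r) \<Rightarrow> 'v::zero poly \<Rightarrow> nat \<Rightarrow> 'r::comm_monoid_add" where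
  "shift_extension f S p = fold_coeffs (\<lambda>a g n. f a n + S g n) p (\<lambda>_. 0)"

lemma shift_extension_0 [simp]: "shift_extension f S 0 = (\<lambda>_. 0)"
  by (simp add: shift_extension_def)

text \<open>The conditions at 0 cover \<open>pCons 0 0 = 0\<close>, which has an empty coefficient
  list.\<close>

lemma shift_extension_pCons:
  assumes "f 0 = (\<lambda>_. 0)" "S (\<lambda>_. 0) = (\<lambda>_. 0)"
  shows "shift_extension f S (pCons a p) = (\<lambda>n. f a n + S (shift_extension f S p) n)"
  using assms by (cases "p = 0 \<and> a = 0") (auto simp: shift_extension_def)

text \<open>Freeness at work: bilinear data on the generators, with finitely many nonzero products
  for each pair, determine all products through the two rules for \<partial>.\<close>

locale free_products = complex_space scale
  for scale :: "complex \<Rightarrow> 'v::ab_group_add \<Rightarrow> 'v" +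
  fixes x :: "'v \<Rightarrow> 'v \<Rightarrow> nat \<Rightarrow> 'v poly"
  assumes x_add_left: "x (a + a') b n = x a b n + x a' b n"
    and x_add_right: "x a (b + b') n = x a b n + x a b' n"
    and x_scale_left: "x (scale c a) b n = free_scale scale c (x a b n)"
    and x_scale_right: "x a (scale c b) n = free_scale scale c (x a b n)"
    and x_finite: "\<exists>B. \<forall>n\<ge>B. x a b n = 0"
begin

sublocale F: del_module "free_scale scale" free_del
  by (rule del_module_free)

lemma x_zero_left [simp]: "x 0 b = (\<lambda>_. 0)"
  using x_add_left[of 0 0 b] by (simp add: fun_eq_iff)

lemma x_zero_right [simp]: "x a 0 = (\<lambda>_. 0)"
  using x_add_right[of a 0 0] by (simp add: fun_eq_iff)

text \<open>The arguments are extended one after the other, the right one first, so that each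
  extension involves a single shift.\<close>

definition row :: "'v \<Rightarrow> 'v poly \<Rightarrow> nat \<Rightarrow> 'v poly" where
  "row a = shift_extension (x a) F.right_shift"

definition ext_prod :: "'v poly \<Rightarrow> 'v poly \<Rightarrow> nat \<Rightarrow> 'v poly" where
  "ext_prod p q = shift_extension (\<lambda>a. row a q) F.left_shift p"

lemma row_0 [simp]: "row a 0 = (\<lambda>_. 0)"
  by (simp add: row_def)

lemma row_pCons: "row a (pCons b q) = (\<lambda>n. x a b n + F.right_shift (row a q) n)"
  unfolding row_def by (rule shift_extension_pCons) simp_all

lemma row_zero_left [simp]: "row 0 q = (\<lambda>_. 0)"
  by (induction q) (simp_all add: row_pCons)

lemma ext_prod_0 [simp]: "ext_prod 0 q = (\<lambda>_. 0)"
  by (simp add: ext_prod_def)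

lemma ext_prod_pCons: "ext_prod (pCons a p) q = (\<lambda>n. row a q n + F.left_shift (ext_prod p q) n)"
  unfolding ext_prod_def by (rule shift_extension_pCons) simp_all

lemma row_add_left: "row (a + a') q = (\<lambda>n. row a q n + row a' q n)"
  by (induction q) (simp_all add: row_pCons F.right_shift_add x_add_left add_ac)

lemma row_add_right: "row a (p + q) = (\<lambda>n. row a p n + row a q n)"
  by (induction p q rule: poly_induct2)
    (simp_all add: row_pCons F.right_shift_add x_add_right add_ac)

lemma row_scale_left: "row (scale c a) q = (\<lambda>n. free_scale scale c (row a q n))"
  by (induction q) (simp_all add: row_pCons F.right_shift_scale x_scale_left F.scale_right_distrib)

lemma row_scale_right: "row a (free_scale scale c q) = (\<lambda>n. free_scale scale c (row a q n))"
  by (induction q) (simp_all add: row_pCons free_scale_pCons F.right_shift_scale x_scale_right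
      F.scale_right_distrib)

lemma row_free_del: "row a (free_del q) = F.right_shift (row a q)"
  by (simp add: free_del_def row_pCons)

lemma row_finite: "\<exists>B. \<forall>n\<ge>B. row a q n = 0"
proof (induction q)
  case (pCons b q)
  then obtain B where B: "\<forall>n\<ge>B. row a q n = 0" by blast
  obtain C where C: "\<forall>n\<ge>C. x a b n = 0" using x_finite by blast
  have "row a (pCons b q) n = 0" if "n \<ge> Suc (max B C)" for n
  proof -
    have "B \<le> n - 1" "B \<le> n" "C \<le> n" using that by auto
    then show ?thesis by (simp add: row_pCons F.right_shift_def B C F.D.zero)
  qed
  then show ?case by blast
qed simp

lemma ext_prod_finite: "\<exists>B. \<forall>n\<ge>B. ext_prod p q n = 0"
proof (induction p)
  case (pCons a p)
  then obtain B where B: "\<forall>n\<ge>B. ext_prod p q n = 0" by blast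
  obtain C where C: "\<forall>n\<ge>C. row a q n = 0" using row_finite by blast
  have "ext_prod (pCons a p) q n = 0" if "n \<ge> Suc (max B C)" for n
  proof -
    have "B \<le> n - 1" "C \<le> n" using that by auto
    then show ?thesis by (simp add: ext_prod_pCons F.left_shift_def B C)
  qed
  then show ?case by blast
qed simp

lemma ext_prod_add_left: "ext_prod (p + q) r = (\<lambda>n. ext_prod p r n + ext_prod q r n)"
  by (induction p q rule: poly_induct2)
    (simp_all add: ext_prod_pCons F.left_shift_add row_add_left add_ac)

lemma ext_prod_add_right: "ext_prod p (q + r) = (\<lambda>n. ext_prod p q n + ext_prod p r n)"
  by (induction p)
    (simp_all add: ext_prod_pCons F.left_shift_add row_add_right add_ac)

lemma ext_prod_scale_left: "ext_prod (free_scale scale c p) q = (\<lambda>n. free_scale scale c (ext_prod p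
    q n))"
  by (induction p) (simp_all add: ext_prod_pCons free_scale_pCons F.left_shift_scale row_scale_left
      F.scale_right_distrib)

lemma ext_prod_scale_right: "ext_prod p (free_scale scale c q) = (\<lambda>n. free_scale scale c (ext_prod p
    q n))"
  by (induction p) (simp_all add: ext_prod_pCons F.left_shift_scale row_scale_right
      F.scale_right_distrib)

lemma ext_prod_gens: "ext_prod [:a:] [:b:] = x a b"
  by (simp add: ext_prod_pCons row_pCons)

lemma ext_prod_del_left: "ext_prod (free_del p) q = F.left_shift (ext_prod p q)"
  by (simp add: free_del_def ext_prod_pCons)

text \<open>The left rule is built into the recursion; the right rule holds on rows and passes
  through the recursion because the two shifts commute.\<close>

lemma ext_prod_del_right: "ext_prod p (free_del q) = F.right_shift (ext_prod p q)"
  by (induction p)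
    (simp_all add: ext_prod_pCons row_free_del F.right_shift_add F.left_right_shift)

lemma n_products_ext_prod: "n_products (free_scale scale) free_del ext_prod"
  by unfold_locales
    (auto simp: bilinear_op_def Vector_Spaces.linear_iff F.vector_space_axioms ext_prod_add_left
      ext_prod_add_right ext_prod_scale_left ext_prod_scale_right ext_prod_finite ext_prod_del_left)

lemma graded_ext_prod:
  assumes "superspace scale V"
    and graded: "\<And>i j a b n. a \<in> V i \<Longrightarrow> b \<in> V j \<Longrightarrow> x a b n \<in> free_grading V (i + j)"
  shows "graded_op (free_grading V) (\<lambda>p q. ext_prod p q n)"
proof -
  interpret superspace scale V by fact
  interpret FS: superspace "free_scale scale" "free_grading V" by (rule superspace_free)
  note closed = F.subspace_add[OF FS.subspace_G] F.subspace_scale[OF FS.subspace_G]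
    F.subspace_neg[OF FS.subspace_G]
  have del: "free_del p \<in> free_grading V i" if "p \<in> free_grading V i" for p i
    using that subspace_0[OF subspace_G]
    by (auto simp: free_grading_def free_del_def coeff_pCons split: nat.splits)
  have zero: "0 \<in> V i" for i
    using subspace_G by (rule subspace_0)
  have "\<forall>n. ext_prod p q n \<in> free_grading V (i + j)"
    if p: "p \<in> free_grading V i" and q: "q \<in> free_grading V j" for i j p q
  proof (rule free_module_induct[of p "V i"])
    fix a assume a: "a \<in> V i"
    show "\<forall>n. ext_prod [:a:] q n \<in> free_grading V (i + j)"
    proof (rule free_module_induct[of q "V j"])
      show "\<forall>n. ext_prod [:a:] [:b:] n \<in> free_grading V (i + j)" if "b \<in> V j" for b
        unfolding ext_prod_gens using graded[OF a that] by blast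
    qed (use q zero in \<open>auto simp: free_grading_def[of V j] ext_prod_del_right F.right_shift_def
        ext_prod_add_right intro!: closed del\<close>)
  qed (use p zero in \<open>auto simp: free_grading_def[of V i] ext_prod_del_left F.left_shift_def
      ext_prod_add_left intro!: closed\<close>)
  then show ?thesis
    by (simp add: graded_op_def)
qed

end

section \<open>The commutator formula on generators\<close>

text \<open>The product \<open>st\<close> of index 1 is left open so that both directions share the
  computation: it is \<open>sym_circ\<close> when \<open>P\<close> is constructed, and a coefficient
  still to be identified when \<open>P\<close> is given.\<close>

locale gd_products = base: complex_space scale + n_products "free_scale scale" free_del P
  for scale :: "complex \<Rightarrow> 'v::ab_group_add \<Rightarrow> 'v" and P +
  fixes br circ st :: "'v \<Rightarrow> 'v \<Rightarrow> 'v"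
  assumes P_gens: "P [:u:] [:v:] = (\<lambda>n. if n = 0 then [:br v u, circ v u:] else if n = 1 then [:st v
      u:] else 0)"
    and P_gens_del: "P [:u:] (free_del [:v:]) = right_shift (P [:u:] [:v:])"
begin

text \<open>A product of two generators has degree at most 1 in \<partial>, so this formula and its
  mirror image evaluate every double product in the defect on generators.\<close>

lemma P_gen_linear: "P [:u:] [:a, b:] n =
    (if n = 0 then [:br a u, circ a u + br b u, circ b u:]
     else if n = 1 then [:st a u + br b u, st b u + circ b u:]
     else if n = 2 then [:st b u + st b u:] else 0)"
proof -
  have two: "free_scale scale 2 [:y:] = [:y + y:]" for y
    using base.scale_left_distrib[of 1 1 y] by (simp add: base.free_scale_pCons)
  have "P [:u:] [:a, b:] n = P [:u:] [:a:] n + P [:u:] (free_del [:b:]) n"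
    by (simp add: pCons_free_del[of a "[:b:]"] P_add_right)
  then show ?thesis
    by (auto simp: P_gens_del right_shift_def P_gens two) (simp_all add: free_del_def)
qed

lemma P_linear_gen: "P [:a, b:] [:w:] n =
    (if n = 0 then [:br w a, circ w a:]
     else if n = 1 then [:st w a - br w b, - circ w b:]
     else if n = 2 then [:- st w b - st w b:] else 0)"
proof -
  have two: "free_scale scale 2 [:y:] = [:y + y:]" for y
    using base.scale_left_distrib[of 1 1 y] by (simp add: base.free_scale_pCons)
  have "P [:a, b:] [:w:] n = P [:a:] [:w:] n + P (free_del [:b:]) [:w:] n"
    by (simp add: pCons_free_del[of a "[:b:]"] P_add_left)
  then show ?thesis
    by (auto simp: P_left_nth P_gens two)
qed

lemma jacobi_defect_gens_00:
  "jacobi_defect s [:u:] [:v:] [:w:] 0 0 =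
    [: br (br w v) u - scale s (br (br w u) v) - br w (br v u),
       circ (br w v) u + br (circ w v) u - scale s (circ (br w u) v + br (circ w u) v) - circ w (br
           v u),
       circ (circ w v) u - scale s (circ (circ w u) v) :]"
  by (simp add: jacobi_defect_def P_gens P_gen_linear P_linear_gen base.free_scale_pCons)

lemma jacobi_defect_gens_10:
  "jacobi_defect s [:u:] [:v:] [:w:] 1 0 =
    [: st (br w v) u + br (circ w v) u - scale s (br (st w u) v) - br w (st v u) - st w (br v u) +
        br w (circ v u),
       st (circ w v) u + circ (circ w v) u - scale s (circ (st w u) v) - circ w (st v u) + circ w
           (circ v u) :]"
  by (simp add: jacobi_defect_def P_gens P_gen_linear P_linear_gen base.free_scale_pCons algebra_simps)

lemma jacobi_defect_gens_01:
  "jacobi_defect s [:u:] [:v:] [:w:] 0 1 =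
    [: br (st w v) u - scale s (st (br w u) v + br (circ w u) v) - st w (br v u) + br w (circ v u),
       circ (st w v) u - scale s (st (circ w u) v + circ (circ w u) v) + circ w (circ v u) :]"
  by (simp add: jacobi_defect_def P_gens P_gen_linear P_linear_gen base.free_scale_pCons algebra_simps)

lemma jacobi_defect_gens_11:
  "jacobi_defect s [:u:] [:v:] [:w:] 1 1 =
    [: st (st w v) u - scale s (st (st w u) v) - st w (st v u) + st w (circ v u) + st w (circ v u) :]"
  by (simp add: jacobi_defect_def P_gens P_gen_linear P_linear_gen base.free_scale_pCons algebra_simps
      numeral_2_eq_2[symmetric])

lemma jacobi_defect_gens_20:
  "jacobi_defect s [:u:] [:v:] [:w:] 2 0 =
    [: st (circ w v) u + st (circ w v) u - st w (st v u) - st w (st v u) + st w (circ v u) + st w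
        (circ v u) :]"
proof -
  have two: "scale 2 y = y + y" for y
    using base.scale_left_distrib[of 1 1 y] by simp
  show ?thesis
  by (simp add: jacobi_defect_def P_gens P_gen_linear P_linear_gen base.free_scale_pCons algebra_simps
      atMost_nat_numeral two numeral_2_eq_2)
qed

lemma jacobi_defect_gens_02:
  "jacobi_defect s [:u:] [:v:] [:w:] 0 2 =
    [: - scale s (st (circ w u) v + st (circ w u) v) + st w (circ v u) + st w (circ v u) :]"
  by (simp add: jacobi_defect_def P_gens P_gen_linear P_linear_gen base.free_scale_pCons algebra_simps)

text \<open>The assumption spells out \<open>m + n \<ge> 3\<close>. A product of generators of index
  0 is linear and one of index 1 is constant in \<partial>, so in a nonzero double product the
  indices add up to at most 2.\<close>

lemma jacobi_defect_gens_high: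
  assumes "m \<ge> 3 \<or> n \<ge> 3 \<or> (m, n) \<in> {(1, 2), (2, 1), (2, 2)}"
  shows "jacobi_defect s [:u:] [:v:] [:w:] m n = 0"
proof -
  have "P [:u:] (P [:v:] [:w:] n) m = 0" "P [:v:] (P [:u:] [:w:] m) n = 0"
    using assms by (auto simp: P_gens P_gen_linear)
  moreover have "P (P [:u:] [:v:] (m - l)) [:w:] (n + l) = 0" if "l \<le> m" for l
    using assms that by (auto simp: P_gens P_linear_gen)
  ultimately show ?thesis
    by (simp add: jacobi_defect_def)
qed

end

section \<open>From bialgebras to conformal superalgebras\<close>

lemma parity_sign_commute: "parity_sign i j = parity_sign j i"
  by (simp add: parity_sign_def)

text \<open>The sign is a bicharacter of \<int>/2, which resolves the signs of composite
  arguments.\<close>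

lemma parity_sign_add_left: "parity_sign (i + j) l = parity_sign i l * parity_sign j l"
  by (cases "i = 0"; cases "j = 0"; cases "l = 0") (simp_all add: parity_sign_def)

lemma parity_sign_square [simp]: "parity_sign i j * parity_sign i j = 1"
  by (simp add: parity_sign_def)

lemma parity_sign_square_left [simp]: "parity_sign i j * (parity_sign i j * c) = c"
  by (simp add: parity_sign_def)

lemma parity_sign_nonzero: "parity_sign i j \<noteq> 0"
  by (simp add: parity_sign_def)

context superspace
begin

text \<open>The projection onto \<open>G 1\<close> along \<open>G 0\<close>; it lets the sign of
  homogeneous elements be expressed by a bilinear formula.\<close>

definition odd_part :: "'a \<Rightarrow> 'a" where
  "odd_part v = (THE b. b \<in> G 1 \<and> v - b \<in> G 0)"

lemma odd_part_eq:
  assumes "b \<in> G 1" "v - b \<in> G 0"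
  shows "odd_part v = b"
  unfolding odd_part_def
proof (rule the_equality)
  fix c assume c: "c \<in> G 1 \<and> v - c \<in> G 0"
  have "c - b \<in> G 1"
    using c assms(1) subspace_diff[OF subspace_G] by blast
  moreover have "(v - b) - (v - c) \<in> G 0"
    using c assms(2) subspace_diff[OF subspace_G] by blast
  then have "c - b \<in> G 0"
    by simp
  ultimately have "c - b \<in> {0}"
    using G_inter by blast
  then show "c = b" by simp
qed (use assms in simp)

lemma odd_part_mem: "odd_part v \<in> G 1" "v - odd_part v \<in> G 0"
proof -
  obtain a b where "a \<in> G 0" "b \<in> G 1" "v = a + b"
    using G_sum by blast
  then show "odd_part v \<in> G 1" "v - odd_part v \<in> G 0"
    using odd_part_eq[of b v] by auto
qed

lemma odd_part_add: "odd_part (u + v) = odd_part u + odd_part v"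
proof (rule odd_part_eq)
  have "(u - odd_part u) + (v - odd_part v) \<in> G 0"
    by (intro subspace_add[OF subspace_G] odd_part_mem)
  then show "u + v - (odd_part u + odd_part v) \<in> G 0"
    by (simp add: algebra_simps)
qed (intro subspace_add[OF subspace_G] odd_part_mem)

lemma odd_part_scale: "odd_part (scale c v) = scale c (odd_part v)"
proof (rule odd_part_eq)
  have "scale c (v - odd_part v) \<in> G 0"
    by (intro subspace_scale[OF subspace_G] odd_part_mem)
  then show "scale c v - scale c (odd_part v) \<in> G 0"
    by (simp add: scale_right_diff_distrib)
qed (intro subspace_scale[OF subspace_G] odd_part_mem)

lemma odd_part_homogeneous: "v \<in> G i \<Longrightarrow> odd_part v = (if i = 1 then v else 0)"
  using odd_part_eq[of v v] odd_part_eq[of 0 v] subspace_0[OF subspace_G] by (cases "i = 1") auto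

end

lemma bilinear_op_rules:
  assumes "bilinear_op scale f"
  shows "f (u + u') v = f u v + f u' v" "f u (v + v') = f u v + f u v'"
    "f (scale c u) v = scale c (f u v)" "f u (scale c v) = scale c (f u v)"
  using assms by (auto simp: bilinear_op_def Vector_Spaces.linear_iff)

lemma bilinear_op_minus:
  assumes "bilinear_op scale f"
  shows "f (u - u') v = f u v - f u' v" "f u (v - v') = f u v - f u v'"
    "f (- u) v = - f u v" "f u (- v) = - f u v"
proof -
  note r = bilinear_op_rules[OF assms]
  show "f (u - u') v = f u v - f u' v" for u u' using r(1)[of "u - u'" u' v] by simp
  show "f u (v - v') = f u v - f u v'" for v v' using r(2)[of u "v - v'" v'] by simp
  show "f (- u) v = - f u v" using r(1)[of "- u" u v] r(1)[of 0 0 v] by (simp add: eq_neg_iff_add_eq_0)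
  show "f u (- v) = - f u v" using r(2)[of u "- v" v] r(2)[of u 0 0] by (simp add: eq_neg_iff_add_eq_0)
qed

context super_gelfand_dorfman
begin

text \<open>On homogeneous arguments this is the coefficient of \<open>z\<^sup>-\<^sup>2\<close> in the formula for \<open>Y\<^sup>+\<close>;
  subtracting the odd parts twice makes the sign \<open>(-1)\<^sup>i\<^sup>j\<close> bilinear.\<close>

definition sym_circ :: "'a \<Rightarrow> 'a \<Rightarrow> 'a" where
  "sym_circ v u = circ v u + circ u v - (circ (odd_part u) (odd_part v) + circ (odd_part u)
      (odd_part v))"

lemmas circ_rules = bilinear_op_rules[OF circ_bilinear] bilinear_op_minus[OF circ_bilinear]
lemmas br_rules = bilinear_op_rules[OF br_bilinear] bilinear_op_minus[OF br_bilinear]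

lemma sym_circ_add: "sym_circ (u + u') v = sym_circ u v + sym_circ u' v"
    "sym_circ u (v + v') = sym_circ u v + sym_circ u v'"
  by (simp_all add: sym_circ_def odd_part_add circ_rules)

lemma sym_circ_scale: "sym_circ (scale c u) v = scale c (sym_circ u v)"
    "sym_circ u (scale c v) = scale c (sym_circ u v)"
  by (simp_all add: sym_circ_def odd_part_scale circ_rules scale_right_distrib scale_right_diff_distrib)

lemma sym_circ_bilinear: "bilinear_op scale sym_circ"
  using vector_space_axioms
  by (simp add: bilinear_op_def Vector_Spaces.linear_iff sym_circ_add sym_circ_scale)

lemmas sym_circ_rules = bilinear_op_rules[OF sym_circ_bilinear] bilinear_op_minus[OF sym_circ_bilinear]

lemma circ_mem: "u \<in> A i \<Longrightarrow> v \<in> A j \<Longrightarrow> circ u v \<in> A (i + j)"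
  using circ_graded unfolding graded_op_def by blast

lemma br_mem: "u \<in> A i \<Longrightarrow> v \<in> A j \<Longrightarrow> br u v \<in> A (i + j)"
  using br_graded unfolding graded_op_def by blast

text \<open>The odd parts are both present exactly when the sign is negative, and subtracting
  \<open>circ u v\<close> twice then reverses it.\<close>

lemma sym_circ_homogeneous:
  assumes "u \<in> A i" "v \<in> A j"
  shows "sym_circ v u = circ v u + scale (parity_sign i j) (circ u v)"
proof -
  have "circ 0 y = 0" "circ y 0 = 0" for y
    using circ_rules(1)[of 0 0 y] circ_rules(2)[of y 0 0] by simp_all
  then show ?thesis
    by (simp add: sym_circ_def odd_part_homogeneous[OF assms(1)] odd_part_homogeneous[OF assms(2)]
        parity_sign_def)
qed

section \<open>The defect identities for homogeneous elements of a bialgebra\<close>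

context
  fixes u v w i j l and s a b :: complex
  assumes u: "u \<in> A i" and v: "v \<in> A j" and w: "w \<in> A l"
    and s: "s = parity_sign i j" and a: "a = parity_sign i l" and b: "b = parity_sign j l"
begin

text \<open>The axioms are written as expressions equal to 0, each for several orders of the
  arguments. A defect identity is then proved by exhibiting its left side as a combination of such
  expressions.\<close>

lemma right_comm_zero:
  "circ (circ w v) u - scale s (circ (circ w u) v) = 0"
  "circ (circ v w) u - scale a (circ (circ v u) w) = 0"
  "circ (circ u w) v - scale b (circ (circ u v) w) = 0"
  using circ_right_comm[OF w v u] circ_right_comm[OF v w u] circ_right_comm[OF u w v]
  by (simp_all add: s a b parity_sign_commute)

lemma left_sym_zero:
  "circ (circ w u) v - circ w (circ u v) - scale a (circ (circ u w) v - circ u (circ w v)) = 0"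
  "circ (circ w v) u - circ w (circ v u) - scale b (circ (circ v w) u - circ v (circ w u)) = 0"
  "circ (circ u v) w - circ u (circ v w) - scale s (circ (circ v u) w - circ v (circ u w)) = 0"
  using circ_left_sym[OF w u v] circ_left_sym[OF w v u] circ_left_sym[OF u v w]
  by (simp_all add: s a b associator_def parity_sign_commute)

lemma compatible_zero:
  "br (circ w v) u - scale s (br (circ w u) v) + circ (br w v) u - scale s (circ (br w u) v) - circ
      w (br v u) = 0"
  "br (circ u w) v - scale b (br (circ u v) w) + circ (br u w) v - scale b (circ (br u v) w) - circ
      u (br w v) = 0"
  "br (circ v w) u - scale a (br (circ v u) w) + circ (br v w) u - scale a (circ (br v u) w) - circ
      v (br w u) = 0"
  using compatible[OF v u, of w] compatible[OF w v, of u] compatible[OF w u, of v]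
  by (simp_all add: s a b parity_sign_commute)

lemma grades:
  "circ u v \<in> A (i + j)" "circ v u \<in> A (i + j)" "circ u w \<in> A (i + l)"
  "circ w u \<in> A (i + l)" "circ v w \<in> A (j + l)" "circ w v \<in> A (j + l)"
  "br v u \<in> A (i + j)" "br w u \<in> A (i + l)" "br w v \<in> A (j + l)"
  "br u v \<in> A (i + j)" "br u w \<in> A (i + l)" "br v w \<in> A (j + l)"
  using circ_mem[OF u v] circ_mem[OF v u] circ_mem[OF u w] circ_mem[OF w u] circ_mem[OF v w]
      circ_mem[OF w v]
    br_mem[OF u v] br_mem[OF v u] br_mem[OF u w] br_mem[OF w u] br_mem[OF v w] br_mem[OF w v]
  by (simp_all only: add.commute)

text \<open>Orients the brackets towards the order \<open>u\<close>, \<open>v\<close>,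
  \<open>w\<close>, with composites before \<open>w\<close>, so that equal terms become
  syntactically equal.\<close>

lemma skew_rules:
  "br w u = - scale a (br u w)" "br w v = - scale b (br v w)" "br v u = - scale s (br u v)"
  "br w (circ u v) = - scale (a * b) (br (circ u v) w)"
  "br w (circ v u) = - scale (a * b) (br (circ v u) w)"
  using br_skew[OF w u] br_skew[OF w v] br_skew[OF v u] br_skew[OF w grades(1)] br_skew[OF w grades(2)]
  by (simp_all only: s a b parity_sign_commute[of l] parity_sign_commute[of j i] parity_sign_add_left)

lemma sym_circ_simps:
  "sym_circ v u = circ v u + scale s (circ u v)"
  "sym_circ w u = circ w u + scale a (circ u w)"
  "sym_circ w v = circ w v + scale b (circ v w)"
  "sym_circ (circ w v) u = circ (circ w v) u + scale (s * a) (circ u (circ w v))"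
  "sym_circ (circ v w) u = circ (circ v w) u + scale (s * a) (circ u (circ v w))"
  "sym_circ (br w v) u = circ (br w v) u + scale (s * a) (circ u (br w v))"
  "sym_circ (circ w u) v = circ (circ w u) v + scale (s * b) (circ v (circ w u))"
  "sym_circ (circ u w) v = circ (circ u w) v + scale (s * b) (circ v (circ u w))"
  "sym_circ (br w u) v = circ (br w u) v + scale (s * b) (circ v (br w u))"
  "sym_circ w (circ u v) = circ w (circ u v) + scale (a * b) (circ (circ u v) w)"
  "sym_circ w (circ v u) = circ w (circ v u) + scale (a * b) (circ (circ v u) w)"
  "sym_circ w (br v u) = circ w (br v u) + scale (a * b) (circ (br v u) w)"
  "sym_circ (br v w) u = circ (br v w) u + scale (s * a) (circ u (br v w))"
  "sym_circ (br u w) v = circ (br u w) v + scale (s * b) (circ v (br u w))"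
  "sym_circ w (br u v) = circ w (br u v) + scale (a * b) (circ (br u v) w)"
  using sym_circ_homogeneous[OF u v] sym_circ_homogeneous[OF u w] sym_circ_homogeneous[OF v w]
    sym_circ_homogeneous[OF u grades(6)] sym_circ_homogeneous[OF u grades(5)]
    sym_circ_homogeneous[OF u grades(9)] sym_circ_homogeneous[OF v grades(4)]
    sym_circ_homogeneous[OF v grades(3)] sym_circ_homogeneous[OF v grades(8)]
    sym_circ_homogeneous[OF grades(1) w] sym_circ_homogeneous[OF grades(2) w]
    sym_circ_homogeneous[OF grades(7) w] sym_circ_homogeneous[OF u grades(12)]
    sym_circ_homogeneous[OF v grades(11)] sym_circ_homogeneous[OF grades(10) w]
  by (simp_all only: s a b parity_sign_commute[of _ "_ + _"] parity_sign_add_left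
      parity_sign_commute[of j i]
      parity_sign_commute[of l])

lemma sign_squares: "s * s = 1" "a * a = 1" "b * b = 1" "s * (s * c) = c" "a * (a * c) = c" "b * (b
    * c) = c"
  by (simp_all add: s a b)

lemmas expand = sign_squares sym_circ_simps sym_circ_rules circ_rules br_rules
  scale_right_distrib scale_right_diff_distrib

lemma jacobi_identity_10:
  "sym_circ (br w v) u + br (circ w v) u - scale s (br (sym_circ w u) v) - br w (sym_circ v u)
     - sym_circ w (br v u) + br w (circ v u) = 0" (is "?L1 = 0")
  "sym_circ (circ w v) u + circ (circ w v) u - scale s (circ (sym_circ w u) v) - circ w (sym_circ v u)
     + circ w (circ v u) = 0" (is "?L2 = 0")
proof -
  \<comment> \<open>The coefficient \<open>- s * a\<close> is forced by
    \<open>circ u (br w v)\<close>, which comes from \<open>sym_circ (br w v) u\<close> and occurs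
    only in the compatibility condition with \<open>u\<close> outermost.\<close>
  have "?L1 = (br (circ w v) u - scale s (br (circ w u) v) + circ (br w v) u - scale s (circ (br w
      u) v) - circ w (br v u))
    - scale (s * a) (br (circ u w) v - scale b (br (circ u v) w) + circ (br u w) v - scale b (circ
        (br u v) w) - circ u (br w v))"
    by (simp add: expand skew_rules mult_ac)
  then show "?L1 = 0"
    unfolding compatible_zero by simp
  \<comment> \<open>Here \<open>circ u (circ w v)\<close> forces \<open>s\<close> times left
    symmetry in \<open>w\<close> and \<open>u\<close>; right commutativity, used twice, absorbs the
    rest.\<close>
  have "?L2 = (circ (circ w v) u - scale s (circ (circ w u) v)) + (circ (circ w v) u - scale s (circ
      (circ w u) v))
    + scale s (circ (circ w u) v - circ w (circ u v) - scale a (circ (circ u w) v - circ u (circ w v)))"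
    by (simp add: expand mult_ac)
  then show "?L2 = 0"
    unfolding right_comm_zero left_sym_zero by simp
qed

lemma jacobi_identity_01:
  "br (sym_circ w v) u - scale s (sym_circ (br w u) v + br (circ w u) v) - sym_circ w (br v u)
     + br w (circ v u) = 0" (is "?L1 = 0")
  "circ (sym_circ w v) u - scale s (sym_circ (circ w u) v + circ (circ w u) v) + circ w (circ v u) =
      0" (is "?L2 = 0")
proof -
  \<comment> \<open>The term \<open>circ v (br w u)\<close> occurs with coefficient
    \<open>- b\<close>, which forces \<open>b\<close> times the compatibility condition with
    \<open>v\<close> outermost.\<close>
  have "?L1 = (br (circ w v) u - scale s (br (circ w u) v) + circ (br w v) u - scale s (circ (br w
      u) v) - circ w (br v u))
    + scale b (br (circ v w) u - scale a (br (circ v u) w) + circ (br v w) u - scale a (circ (br v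
        u) w) - circ v (br w u))"
    by (simp add: expand skew_rules mult_ac)
  then show "?L1 = 0"
    unfolding compatible_zero by simp
  have "?L2 = (circ (circ w v) u - scale s (circ (circ w u) v)) + (circ (circ w v) u - scale s (circ
      (circ w u) v))
    - (circ (circ w v) u - circ w (circ v u) - scale b (circ (circ v w) u - circ v (circ w u)))"
    by (simp add: expand mult_ac)
  then show "?L2 = 0"
    unfolding right_comm_zero left_sym_zero by simp
qed

lemma jacobi_identity_11:
  "sym_circ (sym_circ w v) u - scale s (sym_circ (sym_circ w u) v) - sym_circ w (sym_circ v u)
     + sym_circ w (circ v u) + sym_circ w (circ v u) = 0" (is "?L = 0")
proof -
  \<comment> \<open>Symmetrizing at both levels brings in left symmetry for all three pairs of
    arguments.\<close>
  have "?L = (circ (circ w v) u - scale s (circ (circ w u) v)) + (circ (circ w v) u - scale s (circ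
      (circ w u) v))
    + scale s (circ (circ w u) v - circ w (circ u v) - scale a (circ (circ u w) v - circ u (circ w v)))
    - (circ (circ w v) u - circ w (circ v u) - scale b (circ (circ v w) u - circ v (circ w u)))
    - scale (a * (b * s)) (circ (circ u v) w - circ u (circ v w) - scale s (circ (circ v u) w - circ
        v (circ u w)))"
    by (simp add: expand mult_ac)
  then show ?thesis
    unfolding right_comm_zero left_sym_zero by simp
qed

lemma jacobi_identity_20:
  "sym_circ (circ w v) u - sym_circ w (sym_circ v u) + sym_circ w (circ v u) = 0" (is "?L = 0")
proof -
  have "?L = (circ (circ w v) u - scale s (circ (circ w u) v))
    + scale s (circ (circ w u) v - circ w (circ u v) - scale a (circ (circ u w) v - circ u (circ w v)))
    + scale (a * s) (circ (circ u w) v - scale b (circ (circ u v) w))"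
    by (simp add: expand mult_ac)
  then show ?thesis
    unfolding right_comm_zero left_sym_zero by simp
qed

lemma jacobi_identity_02:
  "- scale s (sym_circ (circ w u) v) + sym_circ w (circ v u) = 0" (is "?L = 0")
proof -
  have "?L = (circ (circ w v) u - scale s (circ (circ w u) v))
    - (circ (circ w v) u - circ w (circ v u) - scale b (circ (circ v w) u - circ v (circ w u)))
    - scale b (circ (circ v w) u - scale a (circ (circ v u) w))"
    by (simp add: expand mult_ac)
  then show ?thesis
    unfolding right_comm_zero left_sym_zero by simp
qed

end

end

text \<open>Homogeneous elements span, so a formula stated for them alone determines a bilinear
  operation.\<close>

lemma bilinear_op_eqI:
  assumes "superspace scale V" "bilinear_op scale f" "bilinear_op scale g"
    and eq: "\<And>i j u v. u \<in> V i \<Longrightarrow> v \<in> V j \<Longrightarrow> f u v = g u v"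
  shows "f = g"
proof (intro ext)
  interpret superspace scale V by fact
  fix u v
  obtain a b where ab: "a \<in> V 0" "b \<in> V 1" and u: "u = a + b" using G_sum by blast
  obtain a' b' where ab': "a' \<in> V 0" "b' \<in> V 1" and v: "v = a' + b'" using G_sum by blast
  show "f u v = g u v"
    unfolding u v by (simp add: bilinear_op_rules[OF assms(2)] bilinear_op_rules[OF assms(3)]
        eq[OF ab(1) ab'(1)] eq[OF ab(1) ab'(2)] eq[OF ab(2) ab'(1)] eq[OF ab(2) ab'(2)])
qed

text \<open>The unique family consists of the coefficients of \<open>r\<close>, viewed as constant
  polynomials.\<close>

lemma free_over_free_gens: "free_over free_del (free_gens :: 'v::ab_group_add poly set)"
  unfolding free_over_def
proof
  have pow: "(free_del ^^ n) [:a:] = monom a n" for n and a :: 'v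
    by (induction n) (simp_all add: monom_0 monom_Suc free_del_def)
  have coeff_sum: "coeff (\<Sum>n | c n \<noteq> 0. (free_del ^^ n) (c n)) m = coeff (c m) 0"
    if c: "range c \<subseteq> free_gens" and fin: "finite {n. c n \<noteq> 0}" for c :: "nat \<Rightarrow> 'v poly" and m
  proof -
    have "(free_del ^^ n) (c n) = monom (coeff (c n) 0) n" for n
    proof -
      obtain a where "c n = [:a:]"
        using c by (auto simp: free_gens_def)
      then show ?thesis by (simp add: pow)
    qed
    then show ?thesis
      using fin by (simp add: coeff_sum if_distrib cong: if_cong)
  qed
  fix r :: "'v poly"
  let ?c = "\<lambda>n. [:coeff r n:]"
  show "\<exists>!c :: nat \<Rightarrow> 'v poly. range c \<subseteq> free_gens \<and> finite {n. c n \<noteq> 0} \<and>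
      r = (\<Sum>n | c n \<noteq> 0. (free_del ^^ n) (c n))"
  proof (rule ex1I[of _ ?c])
    have fin: "finite {n. ?c n \<noteq> 0}"
      by (rule finite_subset[of _ "{..degree r}"]) (auto intro: le_degree)
    have ran: "range ?c \<subseteq> free_gens"
      by (auto simp: free_gens_def)
    show "range ?c \<subseteq> free_gens \<and> finite {n. ?c n \<noteq> 0} \<and>
        r = (\<Sum>n | ?c n \<noteq> 0. (free_del ^^ n) (?c n))"
      using fin ran coeff_sum[OF ran fin] by (simp add: poly_eq_iff)
  next
    fix c :: "nat \<Rightarrow> 'v poly"
    assume c: "range c \<subseteq> free_gens \<and> finite {n. c n \<noteq> 0} \<and> r = (\<Sum>n | c n \<noteq> 0. (free_del ^^ n) (c n))"
    show "c = ?c"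
    proof
      fix n
      have "coeff r n = coeff (c n) 0"
        using c coeff_sum[of c n] by metis
      moreover obtain a where "c n = [:a:]"
        using c by (auto simp: free_gens_def)
      ultimately show "c n = ?c n" by simp
    qed
  qed
qed

lemma gd_formula_iff:
  "gd_formula scale V br circ Y \<longleftrightarrow> (\<forall>i j. \<forall>u\<in>V i. \<forall>v\<in>V j.
     Y [:u:] [:v:] = pole_series (\<lambda>n. if n = 0 then [:br v u, circ v u:]
       else if n = 1 then [:circ v u + scale (parity_sign i j) (circ u v):] else 0))"
proof -
  have "(\<lambda>n. zterm (free_del [:y:] + [:x:]) (- 1) n + zterm [:z:] (- 2) n) =
      pole_series (\<lambda>n. if n = 0 then [:x, y:] else if n = 1 then [:z:] else 0)" for x y z :: 'a
  proof
    fix n :: int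
    consider "n \<ge> 0" | "n = - 1" | "n = - 2" | "n < - 2" by linarith
    then show "zterm (free_del [:y:] + [:x:]) (- 1) n + zterm [:z:] (- 2) n =
      pole_series (\<lambda>n. if n = 0 then [:x, y:] else if n = 1 then [:z:] else 0) n"
      by cases (auto simp: zterm_def pole_series_def free_del_def)
  qed
  then show ?thesis
    unfolding gd_formula_def by simp
qed

text \<open>Skew-symmetry carries a sign and gives the right rule for homogeneous pairs; the rule
  itself is free of signs and extends by additivity.\<close>

lemma (in n_products) homogeneous_P_right:
  assumes "superspace scale R" and d_graded: "\<And>u i. u \<in> R i \<Longrightarrow> d u \<in> R i"
    and sk: "\<And>u v i j. u \<in> R i \<Longrightarrow> v \<in> R j \<Longrightarrow> skew (parity_sign i j) u v"
  shows "P u (d v) = right_shift (P u v)"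
proof -
  interpret superspace scale R by fact
  obtain a b where ab: "a \<in> R 0" "b \<in> R 1" and u: "u = a + b" using G_sum by blast
  obtain a' b' where ab': "a' \<in> R 0" "b' \<in> R 1" and v: "v = a' + b'" using G_sum by blast
  have hom: "P p (d q) = right_shift (P p q)" if "p \<in> R i" "q \<in> R j" for p q i j
    by (rule P_right_if_skew[OF sk[OF that] sk[OF that(1) d_graded[OF that(2)]]])
  show ?thesis
    unfolding u v D.add P_add_left_fun P_add_right_fun right_shift_add
    by (simp add: hom[OF ab(1) ab'(1)] hom[OF ab(1) ab'(2)] hom[OF ab(2) ab'(1)] hom[OF ab(2) ab'(2)])
qed

lemma free_del_graded: "p \<in> free_grading V i \<Longrightarrow> 0 \<in> V i \<Longrightarrow> free_del p \<in> free_grading V i"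
  by (auto simp: free_grading_def free_del_def coeff_pCons split: nat.splits)

section \<open>The conformal superalgebra of a bialgebra\<close>

context super_gelfand_dorfman
begin

definition gen_prod :: "'a \<Rightarrow> 'a \<Rightarrow> nat \<Rightarrow> 'a poly" where
  "gen_prod u v n = (if n = 0 then [:br v u, circ v u:] else if n = 1 then [:sym_circ v u:] else 0)"

sublocale fp: free_products scale gen_prod
proof
  show "\<exists>B. \<forall>n\<ge>B. gen_prod a b n = 0" for a b
    by (rule exI[of _ 2]) (auto simp: gen_prod_def)
qed (simp_all add: gen_prod_def br_rules circ_rules sym_circ_rules free_scale_pCons)

sublocale gp: gd_products scale fp.ext_prod br circ sym_circ
proof -
  interpret n_products "free_scale scale" free_del fp.ext_prod
    by (rule fp.n_products_ext_prod)
  show "gd_products scale fp.ext_prod br circ sym_circ"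
  proof
    show "fp.ext_prod [:u:] [:v:] =
        (\<lambda>n. if n = 0 then [:br v u, circ v u:] else if n = 1 then [:sym_circ v u:] else 0)" for u v
      unfolding fp.ext_prod_gens by (rule ext) (rule gen_prod_def)
    show "fp.ext_prod [:u:] (free_del [:v:]) = fp.F.right_shift (fp.ext_prod [:u:] [:v:])" for u v
      by (rule fp.ext_prod_del_right)
  qed
qed

lemma zero_mem: "0 \<in> A i"
  using subspace_G by (rule subspace_0)

lemma skew_gens:
  assumes "u \<in> A i" "v \<in> A j"
  shows "gp.skew (parity_sign i j) [:u:] [:v:]"
  unfolding gp.skew_def
proof
  fix n :: nat
  have vanish: "fp.ext_prod [:v:] [:u:] m = 0" if "m \<ge> 2" for m
    using that by (simp add: gp.P_gens)
  have n: "n = 0 \<or> n = 1 \<or> n \<ge> 2" by linarith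
  \<comment> \<open>Products of generators vanish from index 2 on, so only \<open>k = 0\<close> and
    \<open>k = 1\<close> can contribute.\<close>
  have sum: "fp.F.skew_sum (fp.ext_prod [:v:] [:u:]) n = (\<Sum>k<2. free_scale scale ((- 1) ^ Suc (n +
      k) / fact k)
      ((free_del ^^ k) (fp.ext_prod [:v:] [:u:] (n + k))))"
    by (rule fp.F.skew_sum_eq[of 2]) (simp_all add: vanish)
  show "fp.ext_prod [:u:] [:v:] n = free_scale scale (parity_sign i j) (fp.F.skew_sum (fp.ext_prod
      [:v:] [:u:]) n)"
    unfolding sum
    using n by (auto simp: gp.P_gens numeral_2_eq_2 free_del_def
      free_scale_pCons br_skew[OF assms(2,1)] sym_circ_homogeneous[OF assms] sym_circ_homogeneous[OF
          assms(2,1)]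
      parity_sign_commute[of j i] scale_right_distrib)
qed

lemma jacobi_gens:
  assumes "u \<in> A i" "v \<in> A j"
  shows "gp.jacobi_defect (parity_sign i j) [:u:] [:v:] [:w:] m n = 0"
proof -
  have hom: "gp.jacobi_defect (parity_sign i j) [:u:] [:v:] [:w:] m n = 0" if w: "w \<in> A l" for w l
  proof -
    \<comment> \<open>The six pairs with \<open>m + n \<le> 2\<close>, and all others
      together.\<close>
    consider "m = 0" "n = 0" | "m = 1" "n = 0" | "m = 0" "n = 1" | "m = 1" "n = 1" | "m = 2" "n = 0"
      | "m = 0" "n = 2" | "m \<ge> 3 \<or> n \<ge> 3 \<or> (m, n) \<in> {(1, 2), (2, 1), (2, 2)}"
    proof -
      have "m = 0 \<or> m = 1 \<or> m = 2 \<or> m \<ge> 3" "n = 0 \<or> n = 1 \<or> n = 2 \<or> n \<ge> 3"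
        by linarith+
      then show ?thesis
        using that by (elim disjE) simp_all
    qed
    then show ?thesis
    proof cases
      case 1
      have "circ (br w v) u + br (circ w v) u - scale (parity_sign i j) (circ (br w u) v + br (circ
          w u) v)
          - circ w (br v u) = 0"
        using compatible_zero(1)[OF assms w refl refl refl] by (simp add: scale_right_distrib
            algebra_simps)
      then show ?thesis
        using 1 right_comm_zero(1)[OF assms w refl refl refl] br_jacobi[OF assms, of w]
        by (simp add: gp.jacobi_defect_gens_00)
    next
      case 2
      then show ?thesis
        using jacobi_identity_10[OF assms w refl refl refl] by (simp only: gp.jacobi_defect_gens_10)
            simp
    next
      case 3
      then show ?thesis
        using jacobi_identity_01[OF assms w refl refl refl] by (simp only: gp.jacobi_defect_gens_01)
            simp
    next
      case 4
      then show ?thesis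
        using jacobi_identity_11[OF assms w refl refl refl] by (simp only: gp.jacobi_defect_gens_11)
            simp
    next
      case 5
      \<comment> \<open>At indices 2 and 0 the defect is twice the identity proved above.\<close>
      let ?x = "sym_circ (circ w v) u - sym_circ w (sym_circ v u) + sym_circ w (circ v u)"
      have "sym_circ (circ w v) u + sym_circ (circ w v) u - sym_circ w (sym_circ v u) - sym_circ w
          (sym_circ v u)
          + sym_circ w (circ v u) + sym_circ w (circ v u) = ?x + ?x"
        by (simp add: algebra_simps)
      also have "?x = 0"
        using assms w refl refl refl by (rule jacobi_identity_20)
      finally have "sym_circ (circ w v) u + sym_circ (circ w v) u - sym_circ w (sym_circ v u) -
          sym_circ w (sym_circ v u)
          + sym_circ w (circ v u) + sym_circ w (circ v u) = 0"
        by simp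
      then show ?thesis
        using 5 by (simp only: gp.jacobi_defect_gens_20) simp
    next
      case 6
      have "- scale (parity_sign i j) (sym_circ (circ w u) v + sym_circ (circ w u) v)
          + sym_circ w (circ v u) + sym_circ w (circ v u) = 0"
        using jacobi_identity_02[OF assms w refl refl refl] by (simp add: scale_right_distrib
            algebra_simps)
      then show ?thesis
        using 6 by (simp only: gp.jacobi_defect_gens_02) simp
    next
      case 7
      then show ?thesis by (rule gp.jacobi_defect_gens_high)
    qed
  qed
  \<comment> \<open>The identities used a grade of \<open>w\<close>, but the sign involves only
    \<open>u\<close> and \<open>v\<close>, so the result extends to arbitrary
    \<open>w\<close>.\<close>
  obtain a b where "a \<in> A 0" "b \<in> A 1" and w: "w = a + b" using G_sum by blast
  moreover have "[:a + b:] = [:a:] + [:b:]" by simp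
  ultimately show ?thesis
    by (simp only: w gp.jacobi_defect_add_3 hom add_0)
qed

text \<open>Induction in both arguments; the constructed products obey the right rule, so
  skew-symmetry spreads from the generators.\<close>

lemma skew_free:
  assumes p: "p \<in> free_grading A i" and q: "q \<in> free_grading A j"
  shows "gp.skew (parity_sign i j) p q"
proof (rule free_module_induct[of p "A i"])
  fix u assume u: "u \<in> A i"
  show "gp.skew (parity_sign i j) [:u:] q"
  proof (rule free_module_induct[of q "A j"])
    show "gp.skew (parity_sign i j) [:u:] [:v:]" if "v \<in> A j" for v
      using u that by (rule skew_gens)
    show "coeff q n \<in> A j" for n
      using q by (simp add: free_grading_def)
    show "gp.skew (parity_sign i j) [:u:] (free_del q)" if "gp.skew (parity_sign i j) [:u:] q" for q
      using that fp.ext_prod_del_right by (rule gp.skew_del_right)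
  qed (rule gp.skew_add_right zero_mem; assumption?)+
next
  show "coeff p n \<in> A i" for n
    using p by (simp add: free_grading_def)
  show "gp.skew (parity_sign i j) (free_del p) q" if "gp.skew (parity_sign i j) p q" for p
    using that fp.ext_prod_del_right by (rule gp.skew_del_left)
qed (rule gp.skew_add_left zero_mem; assumption?)+

text \<open>Induction in all three arguments, over \<open>UNIV\<close> in the third. The quantifiers
  over \<open>m\<close> and \<open>n\<close> stay inside because the rules for \<partial> lower
  these indices.\<close>

lemma jacobi_free:
  assumes p: "p \<in> free_grading A i" and q: "q \<in> free_grading A j"
  shows "\<forall>m n. gp.jacobi_defect (parity_sign i j) p q r m n = 0"
proof (rule free_module_induct[of p "A i"])
  fix u assume u: "u \<in> A i"
  show "\<forall>m n. gp.jacobi_defect (parity_sign i j) [:u:] q r m n = 0"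
  proof (rule free_module_induct[of q "A j"])
    fix v assume v: "v \<in> A j"
    show "\<forall>m n. gp.jacobi_defect (parity_sign i j) [:u:] [:v:] r m n = 0"
    proof (rule free_module_induct[of r UNIV])
      show "\<forall>m n. gp.jacobi_defect (parity_sign i j) [:u:] [:v:] [:w:] m n = 0" for w
        using jacobi_gens[OF u v] by blast
      show "\<forall>m n. gp.jacobi_defect (parity_sign i j) [:u:] [:v:] (free_del r) m n = 0"
        if "\<forall>m n. gp.jacobi_defect (parity_sign i j) [:u:] [:v:] r m n = 0" for r
        unfolding gp.jacobi_defect_del_3[OF fp.ext_prod_del_right] using that fp.F.D.zero by simp
    qed (simp_all add: gp.jacobi_defect_add_3)
  next
    show "coeff q n \<in> A j" for n
      using q by (simp add: free_grading_def)
    show "\<forall>m n. gp.jacobi_defect (parity_sign i j) [:u:] (free_del q) r m n = 0"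
      if "\<forall>m n. gp.jacobi_defect (parity_sign i j) [:u:] q r m n = 0" for q
      unfolding gp.jacobi_defect_del_2[OF fp.ext_prod_del_right] using that by simp
  qed (simp_all add: gp.jacobi_defect_add_2 zero_mem)
next
  show "coeff p n \<in> A i" for n
    using p by (simp add: free_grading_def)
  show "\<forall>m n. gp.jacobi_defect (parity_sign i j) (free_del p) q r m n = 0"
    if "\<forall>m n. gp.jacobi_defect (parity_sign i j) p q r m n = 0" for p
    unfolding gp.jacobi_defect_del_1 using that by simp
qed (simp_all add: gp.jacobi_defect_add_1 zero_mem)

lemma gd_formula_ext_prod: "gd_formula scale A br circ (\<lambda>p q. pole_series (fp.ext_prod p q))"
  unfolding gd_formula_iff
proof (intro allI ballI)
  fix i j u v assume "u \<in> A i" "v \<in> A j"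
  then have st: "sym_circ v u = circ v u + scale (parity_sign i j) (circ u v)"
    by (rule sym_circ_homogeneous)
  show "pole_series (fp.ext_prod [:u:] [:v:]) = pole_series (\<lambda>n. if n = 0 then [:br v u, circ v u:]
      else if n = 1 then [:circ v u + scale (parity_sign i j) (circ u v):] else 0)"
    unfolding gp.P_gens st by (rule refl)
qed

lemma quadratic_ext_prod:
  "quadratic_conformal_superalgebra (free_scale scale) (free_grading A) free_del
     (\<lambda>p q. pole_series (fp.ext_prod p q)) free_gens"
proof -
  have graded: "gen_prod u v n \<in> free_grading A (i + j)" if "u \<in> A i" "v \<in> A j" for u v i j n
  proof -
    have "circ v u \<in> A (i + j)" "circ u v \<in> A (i + j)" "br v u \<in> A (i + j)"
      using circ_mem[OF that] circ_mem[OF that(2,1)] br_mem[OF that(2,1)] by (simp_all only: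
          add.commute)
    then show ?thesis
      using zero_mem by (auto simp: gen_prod_def free_grading_def sym_circ_homogeneous[OF that]
          coeff_pCons
        intro!: subspace_add[OF subspace_G] subspace_scale[OF subspace_G] split: nat.splits)
  qed
  interpret C: conformal_superalgebra "free_scale scale" "free_grading A" free_del
      "\<lambda>p q. pole_series (fp.ext_prod p q)"
    by (rule gp.conformal_superalgebra_pole_series)
      (simp_all add: superspace_free free_del_graded zero_mem skew_free jacobi_free
         fp.graded_ext_prod[OF superspace_axioms graded])
  show ?thesis
  proof
    show "fp.F.subspace free_gens"
      by (auto simp: fp.F.subspace_def free_gens_def free_scale_pCons image_iff)
    show "\<exists>a\<in>free_gens \<inter> free_grading A 0. \<exists>b\<in>free_gens \<inter> free_grading A 1. v = a + b"
      if "v \<in> free_gens" for v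
    proof -
      obtain x where v: "v = [:x:]" using \<open>v \<in> free_gens\<close> by (auto simp: free_gens_def)
      obtain a b where "a \<in> A 0" "b \<in> A 1" "x = a + b" using G_sum by blast
      then show ?thesis
        using zero_mem unfolding v
        by (intro bexI[of _ "[:a:]"] bexI[of _ "[:b:]"])
          (auto simp: free_gens_def free_grading_def coeff_pCons split: nat.splits)
    qed
    show "free_over free_del (free_gens :: 'a poly set)" by (rule free_over_free_gens)
    show "\<exists>w1\<in>free_gens. \<exists>w2\<in>free_gens. \<exists>w3\<in>free_gens.
        pole_series (fp.ext_prod u v) = (\<lambda>n. zterm (w1 + free_del w2) (- 1) n + zterm w3 (- 2) n)"
      if uv: "u \<in> free_gens" "v \<in> free_gens" for u v
    proof -
      obtain x y where [simp]: "u = [:x:]" "v = [:y:]" using uv by (auto simp: free_gens_def)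
      have "pole_series (fp.ext_prod u v) =
         (\<lambda>n. zterm ([:br y x:] + free_del [:circ y x:]) (- 1) n + zterm [:sym_circ y x:] (- 2) n)"
      proof
        fix n :: int
        consider "n \<ge> 0" | "n = - 1" | "n = - 2" | "n < - 2" by linarith
        then show "pole_series (fp.ext_prod u v) n =
            zterm ([:br y x:] + free_del [:circ y x:]) (- 1) n + zterm [:sym_circ y x:] (- 2) n"
          by cases (auto simp: zterm_def pole_series_def free_del_def gp.P_gens)
      qed
      then show ?thesis
        unfolding free_gens_def by blast
    qed
  qed
qed

end

text \<open>The derivation axiom reaches all left arguments over a generator, skew-symmetry
  exchanges the sides, and the derivation axiom then frees the left argument again.\<close>

lemma gd_formula_free_unique:
  assumes V: "superspace scale V"
    and C: "conformal_superalgebra (free_scale scale) (free_grading V) free_del Y"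
    and C': "conformal_superalgebra (free_scale scale) (free_grading V) free_del Y'"
    and gd: "gd_formula scale V br circ Y" and gd': "gd_formula scale V br circ Y'"
  shows "Y' = Y"
proof -
  interpret superspace scale V by fact
  interpret C: conformal_superalgebra "free_scale scale" "free_grading V" free_del Y by fact
  interpret C': conformal_superalgebra "free_scale scale" "free_grading V" free_del Y' by fact
  have lin: "Y (p + p') q n = Y p q n + Y p' q n" "Y p (q + q') n = Y p q n + Y p q' n" for p p' q q' n
    using bilinear_op_rules[OF C.Y_bilinear] by auto
  have lin': "Y' (p + p') q n = Y' p q n + Y' p' q n" "Y' p (q + q') n = Y' p q n + Y' p q' n" for p
      p' q q' n
    using bilinear_op_rules[OF C'.Y_bilinear] by auto
  have zero: "0 \<in> V i" for i
    using subspace_G by (rule subspace_0)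
  have add_left: "Y' (p + p') q = Y (p + p') q" if "Y' p q = Y p q" "Y' p' q = Y p' q" for p p' q
    using that by (simp add: fun_eq_iff lin lin')
  have add_right: "Y' p (q + q') = Y p (q + q')" if "Y' p q = Y p q" "Y' p q' = Y p q'" for p q q'
    using that by (simp add: fun_eq_iff lin lin')
  have del: "Y' (free_del p) q = Y (free_del p) q" if "Y' p q = Y p q" for p q
    using that by (simp add: C.Y_deriv C'.Y_deriv)
  have gens: "Y' [:u:] [:v:] = Y [:u:] [:v:]" if "u \<in> V i" "v \<in> V j" for u v i j
    using gd gd' that unfolding gd_formula_def by metis
  have left: "Y' q [:u:] = Y q [:u:]" if u: "u \<in> V i" and q: "q \<in> free_grading V j" for u q i j
    by (rule free_module_induct[of q "V j"])
      (use q in \<open>simp_all add: free_grading_def gens[OF _ u] del add_left zero\<close>)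
  \<comment> \<open>Skew-symmetry expresses this side through products with a generator on the
    right, which already agree.\<close>
  have right: "Y' [:u:] q = Y [:u:] q" if u: "u \<in> V i" and q: "q \<in> free_grading V j" for u q i j
  proof -
    have u': "[:u:] \<in> free_grading V i"
      using u zero by (auto simp: free_grading_def coeff_pCons split: nat.splits)
    show ?thesis
      unfolding C.Y_skew[OF u' q] C'.Y_skew[OF u' q] left[OF u q] by (rule refl)
  qed
  have "Y' p q = Y p q" for p q
  proof (rule free_module_induct[of p UNIV])
    fix u
    obtain a b where ab: "a \<in> V 0" "b \<in> V 1" "u = a + b" using G_sum by blast
    obtain q0 q1 where q: "q0 \<in> free_grading V 0" "q1 \<in> free_grading V 1" "q = q0 + q1"
      using C.G_sum by blast
    have hom: "Y' [:x:] q = Y [:x:] q" if "x \<in> V i" for x i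
      unfolding q(3) by (intro add_right right[OF that q(1)] right[OF that q(2)])
    have "[:u:] = [:a:] + [:b:]"
      by (simp add: ab(3))
    then show "Y' [:u:] q = Y [:u:] q"
      using add_left[OF hom[OF ab(1)] hom[OF ab(2)]] by simp
  qed (simp_all add: del add_left)
  then show ?thesis by (intro ext) simp
qed

section \<open>From conformal superalgebras to bialgebras\<close>

locale quadratic_free = superspace scale V +
    Q: quadratic_conformal_superalgebra "free_scale scale" "free_grading V" free_del Y free_gens
  for scale :: "complex \<Rightarrow> 'v::ab_group_add \<Rightarrow> 'v" and V Y
begin

definition Y_prod :: "'v poly \<Rightarrow> 'v poly \<Rightarrow> nat \<Rightarrow> 'v poly" where
  "Y_prod p q = pole_coeff (Y p q)"

text \<open>Dictated by the formula for the coefficient of \<open>z^(-1)\<close>, whose operations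
  take the arguments in reversed order; the same holds for \<open>Y_br\<close>.\<close>

definition Y_circ :: "'v \<Rightarrow> 'v \<Rightarrow> 'v" where
  "Y_circ v u = coeff (Y_prod [:u:] [:v:] 0) 1"

definition Y_br :: "'v \<Rightarrow> 'v \<Rightarrow> 'v" where
  "Y_br v u = coeff (Y_prod [:u:] [:v:] 0) 0"

definition Y_sym :: "'v \<Rightarrow> 'v \<Rightarrow> 'v" where
  "Y_sym v u = coeff (Y_prod [:u:] [:v:] 1) 0"

sublocale N: n_products "free_scale scale" free_del Y_prod
  unfolding Y_prod_def[abs_def] by (rule conformal_n_products) (rule Q.conformal_superalgebra_axioms)

lemma zero_mem: "0 \<in> V i"
  using subspace_G by (rule subspace_0)

lemma gen_mem: "u \<in> V i \<Longrightarrow> [:u:] \<in> free_grading V i"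
  using zero_mem by (auto simp: free_grading_def coeff_pCons split: nat.splits)

lemma Y_prod_skew: "p \<in> free_grading V i \<Longrightarrow> q \<in> free_grading V j \<Longrightarrow> N.skew (parity_sign i j) p q"
  using conformal_skew[OF Q.conformal_superalgebra_axioms] by (simp add: Y_prod_def[abs_def])

lemma Y_prod_jacobi:
  "p \<in> free_grading V i \<Longrightarrow> q \<in> free_grading V j \<Longrightarrow> N.jacobi_defect (parity_sign i j) p q r m n = 0"
  using conformal_jacobi[OF Q.conformal_superalgebra_axioms] by (simp add: Y_prod_def[abs_def])

lemma Y_prod_right: "Y_prod p (free_del q) = N.right_shift (Y_prod p q)"
  by (rule N.homogeneous_P_right[where R = "free_grading V"])
    (simp_all add: superspace_free free_del_graded zero_mem Y_prod_skew)

lemma Y_prod_gens: "Y_prod [:u:] [:v:] n =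
  (if n = 0 then [:Y_br v u, Y_circ v u:] else if n = 1 then [:Y_sym v u:] else 0)"
proof -
  have "[:u:] \<in> free_gens" "[:v:] \<in> free_gens"
    by (simp_all add: free_gens_def)
  then obtain w1 w2 w3 where w: "w1 \<in> free_gens" "w2 \<in> free_gens" "w3 \<in> free_gens"
     "Y [:u:] [:v:] = (\<lambda>n. zterm (w1 + free_del w2) (- 1) n + zterm w3 (- 2) n)"
    using Q.quadratic by blast
  obtain x y z where xyz: "w1 = [:x:]" "w2 = [:y:]" "w3 = [:z:]"
    using w(1-3) by (auto simp: free_gens_def)
  have P: "Y_prod [:u:] [:v:] n = (if n = 0 then [:x, y:] else if n = 1 then [:z:] else 0)" for n
    unfolding Y_prod_def w(4) xyz pole_coeff_def by (auto simp: zterm_def free_del_def)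
  show ?thesis
    by (simp add: Y_circ_def Y_br_def Y_sym_def P)
qed

sublocale G: gd_products scale Y_prod Y_br Y_circ Y_sym
  by unfold_locales (simp_all add: Y_prod_gens fun_eq_iff Y_prod_right[unfolded fun_eq_iff])

lemma Y_prod_add_gens: "Y_prod [:u + u':] [:v:] n = Y_prod [:u:] [:v:] n + Y_prod [:u':] [:v:] n"
    "Y_prod [:u:] [:v + v':] n = Y_prod [:u:] [:v:] n + Y_prod [:u:] [:v':] n"
  using N.P_add_left[of "[:u:]" "[:u':]"] N.P_add_right[of "[:u:]" "[:v:]" "[:v':]"] by simp_all

lemma Y_prod_scale_gens: "Y_prod [:scale c u:] [:v:] n = free_scale scale c (Y_prod [:u:] [:v:] n)"
    "Y_prod [:u:] [:scale c v:] n = free_scale scale c (Y_prod [:u:] [:v:] n)"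
  using N.P_scale_left[of c "[:u:]"] N.P_scale_right[of "[:u:]" c "[:v:]"]
  by (simp_all add: free_scale_pCons)

lemma Y_circ_bilinear: "bilinear_op scale Y_circ"
  using vector_space_axioms
  by (simp add: bilinear_op_def Vector_Spaces.linear_iff Y_circ_def Y_prod_add_gens
      Y_prod_scale_gens coeff_free_scale)

lemma Y_br_bilinear: "bilinear_op scale Y_br"
  using vector_space_axioms
  by (simp add: bilinear_op_def Vector_Spaces.linear_iff Y_br_def Y_prod_add_gens Y_prod_scale_gens
      coeff_free_scale)

lemma Y_prod_graded: "u \<in> V i \<Longrightarrow> v \<in> V j \<Longrightarrow> coeff (Y_prod [:u:] [:v:] n) k \<in> V (i + j)"
  using Q.Y_graded[of "- 1 - int n"] gen_mem[of u i] gen_mem[of v j]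
  by (auto simp: graded_op_def Y_prod_def pole_coeff_def free_grading_def simp del: plus_bit_def)

lemma Y_circ_graded: "graded_op V Y_circ"
  unfolding graded_op_def Y_circ_def using Y_prod_graded by (metis add.commute)

lemma Y_br_graded: "graded_op V Y_br"
  unfolding graded_op_def Y_br_def using Y_prod_graded by (metis add.commute)

text \<open>Skew-symmetry at index 0 compares two coefficients: the constant one is skew-symmetry of
  the bracket, and the one of \<partial> relates \<open>Y_circ v u\<close> to
  \<open>Y_sym u v - Y_circ u v\<close>. Index 1 relates \<open>Y_sym v u\<close> to
  \<open>Y_sym u v\<close>, and together they determine \<open>Y_sym\<close>.\<close>

lemma skew_gens:
  assumes "u \<in> V i" "v \<in> V j"
  shows "Y_br v u = - scale (parity_sign i j) (Y_br u v)"
    and "Y_sym v u = Y_circ v u + scale (parity_sign i j) (Y_circ u v)"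
proof -
  have "Y_prod [:u:] [:v:] 0 = free_scale scale (parity_sign i j) (N.skew_sum (Y_prod [:v:] [:u:]) 0)"
    using Y_prod_skew[OF gen_mem[OF assms(1)] gen_mem[OF assms(2)]] by (simp add: N.skew_def)
  also have "N.skew_sum (Y_prod [:v:] [:u:]) 0 = (\<Sum>k<2. free_scale scale ((- 1) ^ Suc (0 + k) / fact k)
      ((free_del ^^ k) (Y_prod [:v:] [:u:] (0 + k))))"
    by (rule N.skew_sum_eq[of 2]) (simp_all add: G.P_gens)
  also have "\<dots> = [: - Y_br u v, Y_sym u v - Y_circ u v :]"
    by (simp add: G.P_gens numeral_2_eq_2 free_del_def free_scale_pCons)
  finally have "[:Y_br v u, Y_circ v u:] =
      [: - scale (parity_sign i j) (Y_br u v), scale (parity_sign i j) (Y_sym u v - Y_circ u v) :]"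
    by (simp add: G.P_gens free_scale_pCons)
  then have *: "Y_br v u = - scale (parity_sign i j) (Y_br u v)" "Y_circ v u = scale (parity_sign i
      j) (Y_sym u v - Y_circ u v)"
    by simp_all
  show "Y_br v u = - scale (parity_sign i j) (Y_br u v)" by (rule *)
  have "Y_prod [:u:] [:v:] 1 = free_scale scale (parity_sign i j) (N.skew_sum (Y_prod [:v:] [:u:]) 1)"
    using Y_prod_skew[OF gen_mem[OF assms(1)] gen_mem[OF assms(2)]] by (simp add: N.skew_def)
  also have "N.skew_sum (Y_prod [:v:] [:u:]) 1 = (\<Sum>k<2. free_scale scale ((- 1) ^ Suc (1 + k) / fact k)
      ((free_del ^^ k) (Y_prod [:v:] [:u:] (1 + k))))"
    by (rule N.skew_sum_eq[of 2]) (simp_all add: G.P_gens)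
  also have "\<dots> = [: Y_sym u v :]"
    by (simp add: G.P_gens numeral_2_eq_2)
  finally have "Y_sym v u = scale (parity_sign i j) (Y_sym u v)"
    by (simp add: G.P_gens free_scale_pCons)
  then show "Y_sym v u = Y_circ v u + scale (parity_sign i j) (Y_circ u v)"
    using *(2) by (simp add: scale_right_diff_distrib)
qed

lemma jacobi_gens:
  assumes "u \<in> V i" "v \<in> V j"
  shows "N.jacobi_defect (parity_sign i j) [:u:] [:v:] [:w:] m n = 0"
  using Y_prod_jacobi gen_mem assms by blast

lemma gd_formula_of_Y: "gd_formula scale V Y_br Y_circ Y"
  unfolding gd_formula_iff
proof (intro allI ballI)
  fix i j u v assume uv: "u \<in> V i" "v \<in> V j"
  have "Y [:u:] [:v:] = pole_series (Y_prod [:u:] [:v:])"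
    unfolding Y_prod_def pole_series_coeff[OF Q.Y_polar] by (rule refl)
  also have "Y_prod [:u:] [:v:] = (\<lambda>n. if n = 0 then [:Y_br v u, Y_circ v u:]
      else if n = 1 then [:Y_circ v u + scale (parity_sign i j) (Y_circ u v):] else 0)"
    unfolding G.P_gens skew_gens(2)[OF uv] by (rule refl)
  finally show "Y [:u:] [:v:] = pole_series (\<lambda>n. if n = 0 then [:Y_br v u, Y_circ v u:]
      else if n = 1 then [:Y_circ v u + scale (parity_sign i j) (Y_circ u v):] else 0)" .
qed

lemma gelfand_dorfman_of_Y: "super_gelfand_dorfman scale V Y_br Y_circ"
proof -
  note circ_rules = bilinear_op_rules[OF Y_circ_bilinear] bilinear_op_minus[OF Y_circ_bilinear]
  have zero: "Y_br (Y_br w v) u - scale (parity_sign i j) (Y_br (Y_br w u) v) - Y_br w (Y_br v u) = 0"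
      "Y_circ (Y_br w v) u + Y_br (Y_circ w v) u - scale (parity_sign i j) (Y_circ (Y_br w u) v +
          Y_br (Y_circ w u) v)
        - Y_circ w (Y_br v u) = 0"
      "Y_circ (Y_circ w v) u - scale (parity_sign i j) (Y_circ (Y_circ w u) v) = 0"
    if "u \<in> V i" "v \<in> V j" for u v w i j
    using jacobi_gens[OF that, of w 0 0] by (simp_all add: G.jacobi_defect_gens_00)
  have circ_mem: "Y_circ u v \<in> V (i + j)" if "u \<in> V i" "v \<in> V j" for u v i j
    using Y_circ_graded that by (simp only: graded_op_def)
  show ?thesis
  proof
    show "bilinear_op scale Y_br" "bilinear_op scale Y_circ" "graded_op V Y_br" "graded_op V Y_circ"
      by (fact Y_br_bilinear Y_circ_bilinear Y_br_graded Y_circ_graded)+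
    show "Y_br u v = - scale (parity_sign i j) (Y_br v u)" if "u \<in> V i" "v \<in> V j" for u v i j
      using skew_gens(1)[OF that(2,1)] by (simp only: parity_sign_commute)
    show "Y_br w (Y_br v u) = Y_br (Y_br w v) u - scale (parity_sign i j) (Y_br (Y_br w u) v)"
      if "u \<in> V i" "v \<in> V j" for u v w i j
      using zero(1)[OF that, of w] by simp
    show "Y_circ (Y_circ u v) w = scale (parity_sign j l) (Y_circ (Y_circ u w) v)"
      if "u \<in> V i" "v \<in> V j" "w \<in> V l" for u v w i j l
      using zero(3)[OF that(3,2), of u] by (simp add: parity_sign_commute)
    show "Y_br (Y_circ w u) v - scale (parity_sign i j) (Y_br (Y_circ w v) u) + Y_circ (Y_br w u) v
        - scale (parity_sign i j) (Y_circ (Y_br w v) u) - Y_circ w (Y_br u v) = 0"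
      if "u \<in> V i" "v \<in> V j" for u v w i j
      using zero(2)[OF that(2,1), of w] by (simp add: parity_sign_commute scale_right_distrib
          algebra_simps)
    show "associator Y_circ w u v = scale (parity_sign l i) (associator Y_circ u w v)"
      if w: "w \<in> V l" and u: "u \<in> V i" and v: "v \<in> V j" for u v w i j l
    proof -
      let ?s = "parity_sign i j" and ?a = "parity_sign i l" and ?b = "parity_sign j l"
      have "N.jacobi_defect ?s [:u:] [:v:] [:w:] 1 0 = 0"
        by (rule jacobi_gens[OF u v])
      then have "Y_sym (Y_circ w v) u + Y_circ (Y_circ w v) u - scale ?s (Y_circ (Y_sym w u) v)
          - Y_circ w (Y_sym v u) + Y_circ w (Y_circ v u) = 0"
        by (simp only: G.jacobi_defect_gens_10 pCons_eq_0_iff)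
      moreover have "Y_sym (Y_circ w v) u = Y_circ (Y_circ w v) u + scale (?s * ?a) (Y_circ u
          (Y_circ w v))"
        using skew_gens(2)[OF u circ_mem[OF w v]]
        by (simp only: parity_sign_commute[of _ "_ + _"] parity_sign_add_left parity_sign_commute[of
            j i]
            parity_sign_commute[of l] mult.commute)
      moreover have "Y_circ (Y_circ w v) u = scale ?s (Y_circ (Y_circ w u) v)"
        using zero(3)[OF u v, of w] by simp
      ultimately have "scale ?s (Y_circ (Y_circ w u) v - Y_circ w (Y_circ u v) - scale ?a (Y_circ
          (Y_circ u w) v - Y_circ u (Y_circ w v))) = 0"
        unfolding skew_gens(2)[OF u w] skew_gens(2)[OF u v]
        by (simp add: circ_rules algebra_simps)
      then show ?thesis
        by (simp add: associator_def parity_sign_commute[of l] parity_sign_nonzero)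
    qed
  qed
qed

end

theorem theorem2p2:
  fixes scale :: "complex \<Rightarrow> 'v::ab_group_add \<Rightarrow> 'v"
    and V :: "bit \<Rightarrow> 'v set"
  assumes "superspace scale V"
  shows
    "(\<forall>Y. quadratic_conformal_superalgebra
             (free_scale scale) (free_grading V) free_del Y free_gens \<longrightarrow>
        (\<exists>br circ.
           bilinear_op scale br \<and> bilinear_op scale circ \<and>
           gd_formula scale V br circ Y \<and>
           super_gelfand_dorfman scale V br circ \<and>
           (\<forall>br' circ'.
              bilinear_op scale br' \<and> bilinear_op scale circ' \<and>
              gd_formula scale V br' circ' Y \<longrightarrow> br' = br \<and> circ' = circ)))
     \<and>
     (\<forall>br circ. super_gelfand_dorfman scale V br circ \<longrightarrow>
        (\<exists>Y.
           quadratic_conformal_superalgebra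
             (free_scale scale) (free_grading V) free_del Y free_gens \<and>
           gd_formula scale V br circ Y \<and>
           (\<forall>Y'.
              conformal_superalgebra (free_scale scale) (free_grading V) free_del Y' \<and>
              gd_formula scale V br circ Y' \<longrightarrow> Y' = Y)))"
proof (intro conjI allI impI)
  fix Y assume "quadratic_conformal_superalgebra (free_scale scale) (free_grading V) free_del Y
      free_gens"
  then interpret quadratic_free scale V Y
    using assms by (simp add: quadratic_free_def)
  have unique: "br' = Y_br \<and> circ' = Y_circ"
    if "bilinear_op scale br'" "bilinear_op scale circ'" "gd_formula scale V br' circ' Y" for br' circ'
  proof -
    have "br' v u = Y_br v u \<and> circ' v u = Y_circ v u" if "u \<in> V i" "v \<in> V j" for u v i j
    proof -
      have "Y [:u:] [:v:] = pole_series (\<lambda>n. if n = 0 then [:br' v u, circ' v u:]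
         else if n = 1 then [:circ' v u + scale (parity_sign i j) (circ' u v):] else 0)"
        using \<open>gd_formula scale V br' circ' Y\<close> that unfolding gd_formula_iff by blast
      then have "Y_prod [:u:] [:v:] 0 = [:br' v u, circ' v u:]"
        by (simp add: Y_prod_def)
      then show ?thesis
        by (simp add: Y_prod_gens)
    qed
    then show ?thesis
      using bilinear_op_eqI[OF assms that(1) Y_br_bilinear] bilinear_op_eqI[OF assms that(2)
          Y_circ_bilinear]
      by blast
  qed
  show "\<exists>br circ. bilinear_op scale br \<and> bilinear_op scale circ \<and> gd_formula scale V br circ Y \<and>
      super_gelfand_dorfman scale V br circ \<and>
      (\<forall>br' circ'. bilinear_op scale br' \<and> bilinear_op scale circ' \<and> gd_formula scale V br' circ' Y \<longrightarrow>
        br' = br \<and> circ' = circ)"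
    using unique Y_br_bilinear Y_circ_bilinear gd_formula_of_Y gelfand_dorfman_of_Y by blast
next
  fix br circ assume "super_gelfand_dorfman scale V br circ"
  then interpret super_gelfand_dorfman scale V br circ .
  show "\<exists>Y. quadratic_conformal_superalgebra (free_scale scale) (free_grading V) free_del Y free_gens \<and>
      gd_formula scale V br circ Y \<and>
      (\<forall>Y'. conformal_superalgebra (free_scale scale) (free_grading V) free_del Y' \<and>
        gd_formula scale V br circ Y' \<longrightarrow> Y' = Y)"
    using quadratic_ext_prod gd_formula_ext_prod gd_formula_free_unique[OF assms]
      quadratic_conformal_superalgebra.axioms(1)[OF quadratic_ext_prod]
    by blast
qed

end
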